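(* There is an online algorithm (Validate-$\pi$-RAM) in the unit-cost RAM model with $\Theta(\log n)$-bit words which, receiving an integer array $A[1\dots n]$ one value at a time, validates whether $A$ is a border array (i.e. whether $A=\pi_w$ for some word $w$ over some alphabet); it works in linear total time with constant delay and uses a linear number of machine words.
   Context: For a word $w$ of length $n$, $\pi_w[i]$ is the length of the longest proper border (a word that is both a proper prefix and a proper suffix) of $w[1\dots i]$. An online algorithm receives the input values one by one and must output its answer (here: whether the prefix read so far is a valid border array, reporting invalidity as soon as it occurs) after reading each value; the delay is the maximum time spent processing a single input value, and constant delay means this is $O(1)$ in the worst case. *)

theory Defs
  imports Complex_Main "HOL-Library.Sublist" "HOL-Library.Landau_Symbols"
begin

unbundle bit_operations_syntax

definition border :: "'a list \<Rightarrow> 'a list \<Rightarrow> bool" where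
  "border u v \<longleftrightarrow> strict_prefix u v \<and> strict_suffix u v"

text \<open>
  For \<open>1 \<le> i \<le> length w\<close> the set below is finite and contains \<open>0\<close> (the empty word is a proper
  border of every nonempty word), so \<open>Max\<close> is meaningful.
\<close>

definition border_length :: "'a list \<Rightarrow> nat \<Rightarrow> nat" where
  "border_length w i = Max {length u | u. border u (take i w)}"

text \<open>
  The alphabet is arbitrary. A word has finitely many letters, and renaming letters injectively does
  not change borders, so the letters may be taken to be natural numbers. The array
  \<open>A[1\<dots>n]\<close> is the list \<open>[A[1], \<dots>, A[n]]\<close>.
\<close>

definition border_array :: "int list \<Rightarrow> bool" where
  "border_array A \<longleftrightarrow>
     (\<exists>w :: nat list. A = map (\<lambda>i. int (border_length w i)) [1..<Suc (length w)])"

text \<open>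
  A unit-cost RAM with words of \<open>W\<close> bits. Words are natural numbers below \<open>2 ^ W\<close>. A program is a fixed finite list of instructions, it uses
  finitely many registers, and it does not depend on \<open>W\<close>. Jump targets are absolute; the machine
  halts when the program counter leaves the program.
\<close>

type_synonym reg = nat

datatype binop = Add | Sub | Mul | Div | And | Or | Xor | Shl | Shr

datatype instr =
    Const reg nat
  | Move reg reg
  | Op binop reg reg reg  \<comment> \<open>\<open>Op f d a b\<close>: destination \<open>d\<close>, operands \<open>a\<close> and \<open>b\<close>\<close>
  | Load reg reg          \<comment> \<open>\<open>Load d a\<close>: register \<open>d\<close> gets the cell whose address is in \<open>a\<close>\<close>
  | Store reg reg         \<comment> \<open>\<open>Store a b\<close>: the cell whose address is in \<open>a\<close> gets register \<open>b\<close>\<close>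
  | Jump nat
  | Jump_Eq reg reg nat
  | Jump_Less reg reg nat

type_synonym program = "instr list"

record ram_state =
  pc :: nat
  regs :: "reg \<Rightarrow> nat"
  mem :: "nat \<Rightarrow> nat"

definition initial :: ram_state where
  "initial = \<lparr>pc = 0, regs = (\<lambda>_. 0), mem = (\<lambda>_. 0)\<rparr>"

fun apply_op :: "nat \<Rightarrow> binop \<Rightarrow> nat \<Rightarrow> nat \<Rightarrow> nat" where
  "apply_op W Add x y = take_bit W (x + y)"
| "apply_op W Sub x y = nat (take_bit W (int x - int y))"
| "apply_op W Mul x y = take_bit W (x * y)"
| "apply_op W Div x y = x div y"
| "apply_op W And x y = x AND y"
| "apply_op W Or x y = x OR y"
| "apply_op W Xor x y = x XOR y"
| "apply_op W Shl x y = take_bit W (push_bit y x)"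
| "apply_op W Shr x y = drop_bit y x"

definition set_reg :: "reg \<Rightarrow> nat \<Rightarrow> ram_state \<Rightarrow> ram_state" where
  "set_reg d x s = s\<lparr>pc := Suc (pc s), regs := (regs s)(d := x)\<rparr>"

definition branch :: "bool \<Rightarrow> nat \<Rightarrow> ram_state \<Rightarrow> ram_state" where
  "branch b l s = s\<lparr>pc := (if b then l else Suc (pc s))\<rparr>"

fun exec :: "nat \<Rightarrow> instr \<Rightarrow> ram_state \<Rightarrow> ram_state" where
  "exec W (Const d k) s = set_reg d (take_bit W k) s"
| "exec W (Move d a) s = set_reg d (regs s a) s"
| "exec W (Op f d a b) s = set_reg d (apply_op W f (regs s a) (regs s b)) s"
| "exec W (Load d a) s = set_reg d (mem s (regs s a)) s"
| "exec W (Store a b) s = s\<lparr>pc := Suc (pc s), mem := (mem s)(regs s a := regs s b)\<rparr>"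
| "exec W (Jump l) s = branch True l s"
| "exec W (Jump_Eq a b l) s = branch (regs s a = regs s b) l s"
| "exec W (Jump_Less a b l) s = branch (regs s a < regs s b) l s"

fun accessed :: "instr \<Rightarrow> ram_state \<Rightarrow> nat set" where
  "accessed (Load d a) s = {regs s a}"
| "accessed (Store a b) s = {regs s a}"
| "accessed _ s = {}"

text \<open>
  \<open>run W P s t X s'\<close>: started in \<open>s\<close>, the program halts in \<open>s'\<close> after exactly \<open>t\<close> unit-cost
  instructions, and \<open>X\<close> is the set of addresses of the memory cells it reads or writes.
\<close>

inductive run :: "nat \<Rightarrow> program \<Rightarrow> ram_state \<Rightarrow> nat \<Rightarrow> nat set \<Rightarrow> ram_state \<Rightarrow> bool"
  for W :: nat and P :: program where
  halt: "length P \<le> pc s \<Longrightarrow> run W P s 0 {} s"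
| step: "pc s < length P \<Longrightarrow> run W P (exec W (P ! pc s) s) t X s' \<Longrightarrow>
         run W P s (Suc t) (accessed (P ! pc s) s \<union> X) s'"

text \<open>
  An integer input value has to fit into one machine word, in two's complement.
\<close>

definition fits_word :: "nat \<Rightarrow> int \<Rightarrow> bool" where
  "fits_word W x \<longleftrightarrow> 0 < W \<and> - (2 ^ (W - 1)) \<le> x \<and> x < 2 ^ (W - 1)"

definition to_word :: "nat \<Rightarrow> int \<Rightarrow> nat" where
  "to_word W x = nat (take_bit W x)"

text \<open>
  The machine is activated once for every input value: the value is put into register \<open>0\<close> and control
  is transferred to the first instruction; all other registers and the memory keep their contents.
  When the machine halts, register \<open>0\<close> is its answer (nonzero for yes), and only then is the next
  value supplied.
\<close>

definition receive :: "nat \<Rightarrow> int \<Rightarrow> ram_state \<Rightarrow> ram_state" where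
  "receive W x s = s\<lparr>pc := 0, regs := (regs s)(0 := to_word W x)\<rparr>"

text \<open>
  \<open>online_run W P s xs bs ts X\<close>: fed with the values \<open>xs\<close> one at a time, starting in \<open>s\<close>, the machine
  gives the answers \<open>bs\<close> and spends the times \<open>ts\<close> (one entry of each per value), and \<open>X\<close> is
  the set of all memory addresses accessed.
\<close>

inductive online_run ::
  "nat \<Rightarrow> program \<Rightarrow> ram_state \<Rightarrow> int list \<Rightarrow> bool list \<Rightarrow> nat list \<Rightarrow> nat set \<Rightarrow> bool"
  for W :: nat and P :: program where
  finish: "online_run W P s [] [] [] {}"
| input: "run W P (receive W x s) t X s' \<Longrightarrow> online_run W P s' xs bs ts Y \<Longrightarrow>
          online_run W P s (x # xs) ((regs s' 0 \<noteq> 0) # bs) (t # ts) (X \<union> Y)"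

end

theory Submission imports Defs begin

text \<open>Call the position \<open>m\<close> a child of \<open>par m = A[m - 1] + 1\<close>. The value \<open>x > 0\<close> may follow a border
  array of length \<open>i - 1\<close> iff \<open>x\<close> is an ancestor-or-self of \<open>par i\<close> and the nearest one carrying its
  letter. For this set one has \<open>cand m = {m} \<union> (cand (par m) - {A[m]})\<close>, and contracting ancestors
  that carry the same letter (\<open>jump\<close>, the strong failure function) leaves chains whose members satisfy
  \<open>jump m + jump (jump m) \<le> m\<close>. So chains have logarithmic length, and the depths of the members of
  \<open>cand m\<close> fit into a bit mask of one word. It remains to decide ancestry in the \<open>jump\<close> forest in
  constant time while leaves are added. The forest is cut into clusters of logarithmic size: within a
  cluster ancestors are a bit mask, and a cluster that has clusters below it was big enough to pay, one
  entry per member, for a table of all ancestors of its root.\<close>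

section \<open>Borders and candidates\<close>

text \<open>The obstacle is the worst-case delay: walking up a chain of logarithmic length for a
  single value would already be too slow. The depth mask replaces the walk, but it only tells that
  the chain holds some candidate at the depth of \<open>x\<close>; that this candidate is
  \<open>x\<close> itself is the ancestor query. No letter is ever stored, since a nonzero
  \<open>A[m]\<close> names the one candidate whose letter \<open>m\<close> repeats. The inequality
  for \<open>jump\<close> is the periodicity argument known from Knuth-Morris-Pratt matching: nested
  borders that are followed by different letters cannot be too long. The cluster bound
  \<open>2 * dep c\<close> has two halves: the first \<open>dep c\<close> members pay for the space
  of a table, the others write one entry each. A query never reads the possibly unfinished table of
  its own cluster: it moves to the cluster above, which is full.\<close>

text \<open>An infinite sequence with 0-based letters replaces the word, so that all prefixes share
  one \<open>w\<close>; \<open>k\<close> is the length of a proper border of the prefix of length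
  \<open>m\<close>.\<close>

definition bd :: "(nat \<Rightarrow> 'a) \<Rightarrow> nat \<Rightarrow> nat \<Rightarrow> bool" where
  "bd w m k \<longleftrightarrow> k < m \<and> (\<forall>t<k. w t = w (m - k + t))"

definition longest_bd :: "(nat \<Rightarrow> 'a) \<Rightarrow> nat \<Rightarrow> nat \<Rightarrow> bool" where
  "longest_bd w m k \<longleftrightarrow> bd w m k \<and> (\<forall>l. bd w m l \<longrightarrow> l \<le> k)"

definition bd_array :: "(nat \<Rightarrow> 'a) \<Rightarrow> (nat \<Rightarrow> nat) \<Rightarrow> nat \<Rightarrow> bool" where
  "bd_array w a N \<longleftrightarrow> (\<forall>m. 1 \<le> m \<and> m \<le> N \<longrightarrow> longest_bd w m (a m))"

lemma bd_less: "bd w m k \<Longrightarrow> k < m"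
  by (simp add: bd_def)

lemma bd_0: "0 < m \<Longrightarrow> bd w m 0"
  by (simp add: bd_def)

lemma bd_trans:
  assumes "bd w m k" "bd w k l" shows "bd w m l"
  unfolding bd_def
proof (intro conjI allI impI)
  show "l < m" using assms by (simp add: bd_def)
  fix t assume "t < l"
  with assms have "w t = w (k - l + t)" "k - l + t < k" "k < m" "l < k" by (auto simp: bd_def)
  moreover from this assms have "w (k - l + t) = w (m - k + (k - l + t))" by (simp add: bd_def)
  ultimately show "w t = w (m - l + t)" by simp
qed

lemma bd_shorter:
  assumes "bd w m k" "bd w m l" "l < k" shows "bd w k l"
  unfolding bd_def
proof (intro conjI allI impI)
  show "l < k" by fact
  fix t assume "t < l"
  with assms have "w t = w (m - l + t)" "k < m" by (auto simp: bd_def)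
  moreover have "w (k - l + t) = w (m - k + (k - l + t))" using assms \<open>t < l\<close> by (simp add: bd_def)
  ultimately show "w t = w (k - l + t)" using assms by simp
qed

lemma bd_Suc_Suc:
  assumes "k < m" shows "bd w (Suc m) (Suc k) \<longleftrightarrow> bd w m k \<and> w k = w m"
proof -
  have "(\<forall>t<Suc k. w t = w (m - k + t)) \<longleftrightarrow> (\<forall>t<k. w t = w (m - k + t)) \<and> w k = w (m - k + k)"
    by (auto simp: less_Suc_eq)
  then show ?thesis using assms by (simp add: bd_def)
qed

lemma bd_Suc_iff:
  "bd w (Suc m) l \<longleftrightarrow> l = 0 \<or> (\<exists>k. l = Suc k \<and> bd w m k \<and> w k = w m)"
proof (cases l)
  case 0 then show ?thesis by (simp add: bd_0)
next
  case (Suc k)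
  then show ?thesis using bd_Suc_Suc[of k m w] bd_less[of w m k] bd_less[of w "Suc m" l]
    by (cases "k < m") auto
qed

text \<open>The border \<open>u'\<close> gives the prefix of length \<open>u\<close> the period
  \<open>p = u - u'\<close>. If the sum reached \<open>u\<close>, then \<open>p \<le> u''\<close>,
  and going back by \<open>p\<close> from \<open>u'\<close> and from \<open>u''\<close> would lead
  to two places that the border \<open>u''\<close> of \<open>u'\<close> identifies; the letters
  after the two borders would agree.\<close>

lemma bd_sum_less:
  assumes "bd w u u'" "bd w u' u''" "w u'' \<noteq> w u'"
  shows "u' + u'' < u"
proof (rule ccontr)
  assume "\<not> u' + u'' < u"
  define p where "p = u - u'"
  have lt: "u' < u" "u'' < u'" using assms by (auto simp: bd_def)
  have p: "p \<le> u''" using \<open>\<not> u' + u'' < u\<close> by (simp add: p_def)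
  have "w (u' - p) = w (u - u' + (u' - p))" using assms(1) lt p p_def by (simp add: bd_def)
  then have 1: "w (u' - p) = w u'" using p lt p_def by simp
  have "w (u'' - p) = w (u - u' + (u'' - p))" using assms(1) lt p p_def by (simp add: bd_def)
  then have 2: "w (u'' - p) = w u''" using p lt p_def by simp
  have "w (u'' - p) = w (u' - u'' + (u'' - p))" using assms(2) lt p p_def by (simp add: bd_def)
  then have "w (u'' - p) = w (u' - p)" using p lt by simp
  with 1 2 assms(3) show False by simp
qed

section \<open>The parent tree, candidate sets and the strong failure function\<close>

fun par :: "(nat \<Rightarrow> nat) \<Rightarrow> nat \<Rightarrow> nat" where
  "par a 0 = 0"
| "par a (Suc 0) = 0"
| "par a (Suc (Suc m)) = Suc (a (Suc m))"

text \<open>The guard makes the recursion terminate for arbitrary \<open>a\<close>; on the positions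
  of a valid array it fires only at \<open>0\<close>.\<close>

fun cand :: "(nat \<Rightarrow> nat) \<Rightarrow> nat \<Rightarrow> nat set" where
  "cand a m = (if m \<le> par a m then {} else insert m (cand a (par a m) - {a m}))"

text \<open>For a border array, \<open>a m = par a m \<noteq> 0\<close> means that \<open>m\<close>
  repeats the letter of its parent, so the contraction can be computed without letters.\<close>

fun jump :: "(nat \<Rightarrow> nat) \<Rightarrow> nat \<Rightarrow> nat" where
  "jump a m = (if m \<le> par a m then 0
               else if a m = par a m then jump a (par a m) else par a m)"

declare cand.simps [simp del] jump.simps [simp del]

lemma jump_0 [simp]: "jump a 0 = 0" by (simp add: jump.simps)
lemma cand_0 [simp]: "cand a 0 = {}" by (simp add: cand.simps)

lemma jump_less: "0 < m \<Longrightarrow> jump a m < m"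
proof (induction m rule: less_induct)
  case (less m)
  show ?case
  proof (cases "m \<le> par a m \<or> a m \<noteq> par a m")
    case True then show ?thesis using less.prems by (auto simp: jump.simps[of a m])
  next
    case False
    then have "jump a m = jump a (par a m)" by (simp add: jump.simps[of a m])
    moreover have "par a m < m" using False by simp
    ultimately show ?thesis using less.IH[of "par a m"] less.prems by (cases "par a m = 0") auto
  qed
qed

fun depth :: "(nat \<Rightarrow> nat) \<Rightarrow> nat \<Rightarrow> nat" where
  "depth a m = (if m = 0 \<or> m \<le> jump a m then 0 else Suc (depth a (jump a m)))"
declare depth.simps [simp del]

lemma depth_0 [simp]: "depth a 0 = 0" by (simp add: depth.simps)

lemma depth_Suc: "0 < m \<Longrightarrow> depth a m = Suc (depth a (jump a m))"
  using jump_less[of m a] by (simp add: depth.simps[of a m])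

definition valid :: "(nat \<Rightarrow> nat) \<Rightarrow> nat \<Rightarrow> bool" where
  "valid a N \<longleftrightarrow> (\<forall>m. 1 \<le> m \<and> m \<le> N \<longrightarrow> a m = 0 \<or> a m \<in> cand a (par a m))"

lemma bd_array_less: "bd_array w a N \<Longrightarrow> 1 \<le> m \<Longrightarrow> m \<le> N \<Longrightarrow> a m < m"
  by (auto simp: bd_array_def longest_bd_def bd_def)

lemma bd_array_par_less: "bd_array w a N \<Longrightarrow> 1 \<le> m \<Longrightarrow> m \<le> Suc N \<Longrightarrow> par a m < m"
  using bd_array_less[of w a N "m - 1"] by (cases "(a, m)" rule: par.cases) auto

section \<open>Ancestors and their letters in a concrete word\<close>

text \<open>Positions are 1-based, letters 0-based: \<open>z\<close> is above \<open>m\<close> when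
  what precedes position \<open>z\<close> is a border of what precedes position \<open>m\<close>, so
  that only the letters at \<open>z\<close> and \<open>m\<close> remain to be compared.\<close>

definition anc :: "(nat \<Rightarrow> 'a) \<Rightarrow> nat \<Rightarrow> nat \<Rightarrow> bool" where
  "anc w m z \<longleftrightarrow> 1 \<le> z \<and> (z = m \<or> bd w (m - 1) (z - 1))"

definition same :: "(nat \<Rightarrow> 'a) \<Rightarrow> nat \<Rightarrow> nat \<Rightarrow> bool" where
  "same w x y \<longleftrightarrow> w (x - 1) = w (y - 1)"

lemma anc_0 [simp]: "\<not> anc w 0 z" by (auto simp: anc_def bd_def)

lemma anc_le: "anc w m z \<Longrightarrow> z \<le> m" by (auto simp: anc_def bd_def)

lemma bd_eq_anc_par:
  assumes "bd_array w a N" "1 \<le> m" "m \<le> Suc N" "1 \<le> z"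
  shows "bd w (m - 1) (z - 1) \<longleftrightarrow> anc w (par a m) z"
proof (cases "m = 1")
  case True then show ?thesis by (auto simp: bd_def)
next
  case False
  then obtain k where k: "m = Suc (Suc k)" using assms by (metis One_nat_def not0_implies_Suc not_one_le_zero)
  then have "longest_bd w (Suc k) (a (Suc k))" using assms by (simp add: bd_array_def)
  then have L: "bd w (Suc k) (a (Suc k))" "\<And>l. bd w (Suc k) l \<Longrightarrow> l \<le> a (Suc k)"
    by (auto simp: longest_bd_def)
  show ?thesis
  proof
    assume b: "bd w (m - 1) (z - 1)"
    then have "z - 1 = a (Suc k) \<or> z - 1 < a (Suc k)" using L(2) k by force
    then show "anc w (par a m) z"
      using b L(1) k assms(4) by (auto simp: anc_def intro: bd_shorter)
  next
    assume "anc w (par a m) z"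
    then show "bd w (m - 1) (z - 1)" using L(1) k by (auto simp: anc_def intro: bd_trans)
  qed
qed

lemma anc_par:
  assumes "bd_array w a N" "1 \<le> m" "m \<le> Suc N"
  shows "anc w m z \<longleftrightarrow> z = m \<or> anc w (par a m) z"
  using bd_eq_anc_par[OF assms] assms(2) by (auto simp: anc_def)

lemma bd_iff_anc_par:
  assumes "bd_array w a N" "1 \<le> m" "m \<le> Suc N"
  shows "bd w m l \<longleftrightarrow> l = 0 \<or> anc w (par a m) l \<and> same w l m"
proof -
  obtain k where "m = Suc k" using assms(2) by (cases m) auto
  then show ?thesis using bd_eq_anc_par[OF assms, of l]
    by (cases l) (auto simp: bd_Suc_iff same_def anc_def)
qed

definition visible :: "(nat \<Rightarrow> 'a) \<Rightarrow> nat \<Rightarrow> nat \<Rightarrow> bool" where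
  "visible w m z \<longleftrightarrow> anc w m z \<and> (\<forall>y. anc w m y \<and> same w y z \<longrightarrow> y \<le> z)"

text \<open>A nonempty border of length \<open>l\<close> ends with the letter at position
  \<open>l\<close>, so the longest one belongs to the nearest proper ancestor that carries the
  letter of \<open>m\<close>.\<close>

lemma longest_iff_visible:
  assumes "bd_array w a N" "1 \<le> m" "m \<le> Suc N"
  shows "longest_bd w m l \<longleftrightarrow>
    (if l = 0 then \<forall>y. anc w (par a m) y \<longrightarrow> \<not> same w y m
     else visible w (par a m) l \<and> same w l m)"
proof (cases "l = 0")
  case True
  have "anc w p y \<Longrightarrow> y \<noteq> 0" for p y by (simp add: anc_def)
  then show ?thesis using True by (auto simp: longest_bd_def bd_iff_anc_par[OF assms])
next
  case False
  then show ?thesis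
    by (auto simp: longest_bd_def bd_iff_anc_par[OF assms] visible_def same_def)
qed

text \<open>Passing from \<open>par a m\<close> to \<open>m\<close> hides at most one visible node,
  the nearest one with the letter of \<open>m\<close>. By \<open>longest_iff_visible\<close> this is
  \<open>a m\<close>, and \<open>a m = 0\<close> means that nothing is hidden.\<close>

lemma cand_eq_visible:
  assumes "bd_array w a N" "m \<le> N"
  shows "z \<in> cand a m \<longleftrightarrow> visible w m z"
  using assms(2)
proof (induction m arbitrary: z rule: less_induct)
  case (less m)
  show ?case
  proof (cases "m = 0")
    case True then show ?thesis by (simp add: visible_def)
  next
    case False
    let ?p = "par a m"
    have m: "1 \<le> m" "m \<le> Suc N" using False less.prems by auto
    have p: "?p < m" by (rule bd_array_par_less[OF assms(1) m])
    have IH: "z \<in> cand a ?p \<longleftrightarrow> visible w ?p z" for z using less p by simp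
    have L: "longest_bd w m (a m)" using assms(1) m less.prems by (simp add: bd_array_def)
    note l = L[unfolded longest_iff_visible[OF assms(1) m]]
    have ap: "anc w ?p y \<Longrightarrow> y < m" for y using anc_le p by force
    have R: "z \<in> cand a m \<longleftrightarrow> z = m \<or> visible w ?p z \<and> z \<noteq> a m"
      using p IH by (subst cand.simps) auto
    have "visible w m z \<longleftrightarrow> z = m \<or> visible w ?p z \<and> \<not> same w m z"
      unfolding visible_def anc_par[OF assms(1) m] using ap by (auto simp: same_def less_imp_le) (metis nat_less_le not_less)+
    moreover have "same w m z \<longleftrightarrow> z = a m" if "visible w ?p z"
    proof (cases "a m = 0")
      case True
      then show ?thesis using l that by (auto simp: visible_def same_def anc_def)
    next
      case False
      then have "visible w ?p (a m)" "same w (a m) m" using l by auto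
      then show ?thesis using that by (auto simp: visible_def same_def intro: antisym)
    qed
    ultimately show ?thesis using R by blast
  qed
qed

lemma bd_array_imp_valid:
  assumes "bd_array w a N" shows "valid a N"
  unfolding valid_def
proof (intro allI impI)
  fix m assume m: "1 \<le> m \<and> m \<le> N"
  then have L: "longest_bd w m (a m)" "par a m < m"
    using assms bd_array_par_less[OF assms, of m] by (auto simp: bd_array_def)
  then have "a m = 0 \<or> visible w (par a m) (a m)"
    using longest_iff_visible[OF assms, of m "a m"] m by (auto split: if_splits)
  then show "a m = 0 \<or> a m \<in> cand a (par a m)"
    using cand_eq_visible[OF assms, of "par a m"] L m by auto
qed

lemma bd_cong:
  assumes "\<And>t. t < m \<Longrightarrow> w t = v t" shows "bd w m k \<longleftrightarrow> bd v m k"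
  using assms by (auto simp: bd_def)

lemma bd_array_cong:
  assumes "\<And>t. t < N \<Longrightarrow> w t = v t" shows "bd_array w a N \<longleftrightarrow> bd_array v a N"
proof -
  have "\<And>m l. m \<le> N \<Longrightarrow> bd w m l \<longleftrightarrow> bd v m l" using assms by (intro bd_cong) auto
  then show ?thesis unfolding bd_array_def longest_bd_def by blast
qed

text \<open>The word is built greedily: a nonzero entry copies the letter of the position that it
  names, \<open>0\<close> takes a fresh letter. A candidate is visible, so copying its letter makes
  it the longest border.\<close>

lemma valid_imp_bd_array:
  "valid a N \<Longrightarrow> \<exists>w :: nat \<Rightarrow> nat. bd_array w a N"
proof (induction N)
  case 0 show ?case by (simp add: bd_array_def)
next
  case (Suc N)
  then obtain w :: "nat \<Rightarrow> nat" where w: "bd_array w a N" by (auto simp: valid_def)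
  let ?m = "Suc N"
  obtain c where c: "c \<notin> w ` {..<N}" using ex_new_if_finite[OF infinite_UNIV_nat] by blast
  define v where "v = w(N := if a ?m = 0 then c else w (a ?m - 1))"
  have v: "bd_array v a N" using w bd_array_cong[of N w v a] by (simp add: v_def)
  have p: "par a ?m < ?m" by (rule bd_array_par_less[OF v]) auto
  have "longest_bd v ?m (a ?m)"
  proof (subst longest_iff_visible[OF v], simp, simp, cases "a ?m = 0")
    case True
    have "\<not> same v y ?m" if "anc v (par a ?m) y" for y
    proof -
      have "y - 1 < N" using anc_le[OF that] that p by (auto simp: anc_def)
      then show ?thesis using c True by (auto simp: same_def v_def)
    qed
    then show "if a ?m = 0 then \<forall>y. anc v (par a ?m) y \<longrightarrow> \<not> same v y ?m
     else visible v (par a ?m) (a ?m) \<and> same v (a ?m) ?m" using True by simp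
  next
    case False
    then have "a ?m \<in> cand a (par a ?m)" using Suc.prems by (force simp: valid_def)
    then have vis: "visible v (par a ?m) (a ?m)" using cand_eq_visible[OF v, of "par a ?m"] p by simp
    then have "anc v (par a ?m) (a ?m)" by (simp add: visible_def)
    then have "a ?m - 1 < N" using anc_le[of v "par a ?m" "a ?m"] p False by simp
    then have "same v (a ?m) ?m" using False by (simp add: same_def v_def)
    with vis False show "if a ?m = 0 then \<forall>y. anc v (par a ?m) y \<longrightarrow> \<not> same v y ?m
     else visible v (par a ?m) (a ?m) \<and> same v (a ?m) ?m" by simp
  qed
  with v have "bd_array v a ?m" by (auto simp: bd_array_def le_Suc_eq)
  then show ?case by blast
qed

lemma valid_less: "valid a N \<Longrightarrow> 1 \<le> m \<Longrightarrow> m \<le> N \<Longrightarrow> a m < m"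
  using valid_imp_bd_array bd_array_less by blast

lemma valid_par_less: "valid a N \<Longrightarrow> 1 \<le> m \<Longrightarrow> m \<le> Suc N \<Longrightarrow> par a m < m"
  using valid_imp_bd_array bd_array_par_less by blast

section \<open>Logarithmic depth of the jump forest\<close>

text \<open>If \<open>a m = par a m\<close>, then \<open>m\<close> and its parent carry the same
  letter and the claim is inherited from the parent. Otherwise the parent itself differs: with an
  equal letter it would be nearest and hence equal to \<open>a m\<close>.\<close>

lemma jump_anc:
  assumes "bd_array w a N" "m \<le> N" "jump a m \<noteq> 0"
  shows "anc w (par a m) (jump a m) \<and> \<not> same w (jump a m) m"
  using assms(2,3)
proof (induction m rule: less_induct)
  case (less m)
  let ?p = "par a m"
  have m: "1 \<le> m" "m \<le> Suc N" using less.prems by (cases "m = 0", auto)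
  have p: "?p < m" by (rule bd_array_par_less[OF assms(1) m])
  have L: "longest_bd w m (a m)" using assms(1) m less.prems by (simp add: bd_array_def)
  note l = L[unfolded longest_iff_visible[OF assms(1) m]]
  have p0: "?p \<noteq> 0" using less.prems p by (metis jump.simps jump_0 not_le)
  then have ancp: "anc w ?p ?p" by (simp add: anc_def)
  show ?case
  proof (cases "a m = ?p")
    case True
    then have j: "jump a m = jump a ?p" using p by (simp add: jump.simps[of a m])
    have s: "same w ?p m" using l True p0 by simp
    have "anc w (par a ?p) (jump a ?p) \<and> \<not> same w (jump a ?p) ?p"
      using less p j by simp
    then show ?thesis using j s anc_par[OF assms(1), of ?p] p0 p less.prems
      by (auto simp: same_def)
  next
    case False
    then have j: "jump a m = ?p" using p by (simp add: jump.simps[of a m])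
    have "\<not> same w ?p m"
    proof
      assume s: "same w ?p m"
      then have "a m \<noteq> 0" using l ancp by metis
      then have "visible w ?p (a m)" "same w (a m) m" using l by auto
      then have "?p \<le> a m" "a m \<le> ?p"
        using ancp s anc_le by (auto simp: visible_def same_def)
      then show False using False by simp
    qed
    then show ?thesis using j ancp by simp
  qed
qed

lemma jump_sum_le:
  assumes "valid a N" "m \<le> N" "jump a (jump a m) \<noteq> 0"
  shows "jump a m + jump a (jump a m) \<le> m"
proof -
  obtain w :: "nat \<Rightarrow> nat" where w: "bd_array w a N" using valid_imp_bd_array[OF assms(1)] by blast
  let ?j = "jump a m" let ?k = "jump a ?j"
  have j0: "?j \<noteq> 0" using assms(3) by (metis jump_0)
  have m0: "m \<noteq> 0" using j0 by (metis jump_0)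
  have jm: "?j < m" "?k < ?j" using jump_less j0 m0 by auto
  have A: "anc w (par a m) ?j" using jump_anc[OF w assms(2) j0] by simp
  have B: "anc w (par a ?j) ?k" "\<not> same w ?k ?j" using jump_anc[OF w _ assms(3)] jm assms(2) by auto
  have 1: "bd w (m - 1) (?j - 1)" using bd_eq_anc_par[OF w, of m ?j] A m0 j0 assms(2) by simp
  have 2: "bd w (?j - 1) (?k - 1)" using bd_eq_anc_par[OF w, of ?j ?k] B j0 assms(2,3) jm by simp
  \<comment> \<open>Positions exceed border lengths by one, which turns the strict inequality into
    \<open>\<le>\<close>.\<close>
  have "(?j - 1) + (?k - 1) < m - 1" using bd_sum_less[OF 1 2] B(2) by (simp add: same_def)
  then show ?thesis using assms(3) j0 m0 by linarith
qed

text \<open>The second summand in \<open>jump_sum_le\<close> is the smaller one, so two jumps at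
  least halve the position: two levels cost a factor 4, whence the square. The factor 2 inside
  covers chains of at most two nodes.\<close>

lemma depth_bound:
  assumes "valid a N" "1 \<le> m" "m \<le> N"
  shows "2 ^ depth a m \<le> (2 * m)\<^sup>2"
  using assms(2,3)
proof (induction m rule: less_induct)
  case (less m)
  let ?k = "jump a (jump a m)"
  show ?case
  proof (cases "?k = 0")
    case True
    then have "depth a m \<le> 2" using depth_Suc[of m a] depth_Suc[of "jump a m" a] less.prems
      by (cases "jump a m = 0") auto
    then have "(2::nat) ^ depth a m \<le> 2 ^ 2" by (intro power_increasing) auto
    also have "\<dots> \<le> (2 * m)\<^sup>2" using less.prems by (intro power_mono) auto
    finally show ?thesis .
  next
    case False
    then have j0: "0 < jump a m" by (metis jump_0 gr0I)
    have d: "depth a m = Suc (Suc (depth a ?k))" using depth_Suc[of m a] depth_Suc[of "jump a m" a] less.prems j0 by simp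
    have "?k < jump a m" "jump a m < m" using jump_less j0 less.prems by auto
    moreover have "jump a m + ?k \<le> m" using jump_sum_le[OF assms(1) less.prems(2) False] .
    ultimately have k: "2 * ?k \<le> m" "?k < m" by auto
    have "2 ^ depth a ?k \<le> (2 * ?k)\<^sup>2" using less k False by simp
    then have "2 ^ depth a m \<le> (2 * (2 * ?k))\<^sup>2" using d by (simp add: power2_eq_square)
    also have "\<dots> \<le> (2 * m)\<^sup>2" using k by (intro power_mono) auto
    finally show ?thesis .
  qed
qed

section \<open>From sequences back to lists and \<open>border_array\<close>\<close>

lemma lengths_of_borders:
  assumes "m \<le> length w"
  shows "{length u |u. border u (take m w)} = {k. bd ((!) w) m k}"
proof (intro set_eqI iffI; clarsimp)
  fix u assume b: "border u (take m w)"
  then have lt: "length u < m" and p: "prefix u (take m w)" and s: "suffix u (take m w)"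
    using assms prefix_length_less[of u "take m w"] by (auto simp: border_def strict_suffix_def)
  obtain ys where ys: "take m w = u @ ys" using p by (auto simp: prefix_def)
  obtain zs where zs: "take m w = zs @ u" using s by (auto simp: suffix_def)
  have "length zs = m - length u" using arg_cong[OF zs, of length] assms by simp
  have "w ! t = w ! (m - length u + t)" if "t < length u" for t
  proof -
    have "take m w ! t = u ! t" using ys that by (simp add: nth_append)
    moreover have "take m w ! (m - length u + t) = u ! t"
      using zs \<open>length zs = _\<close> that by (simp add: nth_append)
    ultimately show ?thesis using that lt by simp
  qed
  then show "bd ((!) w) m (length u)" using lt by (simp add: bd_def)
next
  fix k assume b: "bd ((!) w) m k"
  then have k: "k < m" by (simp add: bd_def)
  have e: "take k w = drop (m - k) (take m w)"
    using b k assms by (intro nth_equalityI) (auto simp: bd_def)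
  have "prefix (take k w) (take m w)" using k by (metis less_imp_le_nat min.absorb1 take_is_prefix take_take)
  moreover have "suffix (take k w) (take m w)" unfolding e by (rule suffix_drop)
  moreover have "take k w \<noteq> take m w" using k assms by (metis length_take min.absorb2 min.strict_order_iff min_less_iff_conj nat_neq_iff order_less_le_trans)
  ultimately have "border (take k w) (take m w)" by (auto simp: border_def strict_suffix_def)
  then show "\<exists>u. k = length u \<and> border u (take m w)" using k assms by (intro exI[of _ "take k w"]) auto
qed

lemma border_length_eq_iff:
  assumes "1 \<le> m" "m \<le> length w"
  shows "border_length w m = k \<longleftrightarrow> longest_bd ((!) w) m k"
proof -
  have "finite {k. bd ((!) w) m k}" by (rule finite_subset[of _ "{..<m}"]) (auto simp: bd_def)
  moreover have "0 \<in> {k. bd ((!) w) m k}" using assms by (simp add: bd_0)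
  ultimately show ?thesis
    unfolding border_length_def lengths_of_borders[OF assms(2)] longest_bd_def
    by (subst Max_eq_iff) auto
qed

text \<open>Subtracting one shifts to the 1-based indexing of the arrays.\<close>

definition entry :: "int list \<Rightarrow> nat \<Rightarrow> nat" where
  "entry A m = nat (A ! (m - 1))"

text \<open>The sign condition is kept apart because \<open>entry\<close> turns a negative value
  into \<open>0\<close>, which is a legal entry everywhere.\<close>

lemma border_array_iff_valid:
  "border_array A \<longleftrightarrow> (\<forall>x\<in>set A. 0 \<le> x) \<and> valid (entry A) (length A)"
proof
  assume "border_array A"
  then obtain w :: "nat list" where w: "A = map (\<lambda>i. int (border_length w i)) [1..<Suc (length w)]"
    by (auto simp: border_array_def)
  then have len: "length A = length w" by (metis diff_Suc_1 length_map length_upt)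
  have "entry A m = border_length w m" if "1 \<le> m" "m \<le> length w" for m
  proof -
    have "A ! (m - 1) = int (border_length w ([1..<Suc (length w)] ! (m - 1)))"
      using that by (subst w, subst nth_map) auto
    then show ?thesis using that by (simp add: entry_def del: upt_Suc)
  qed
  then have "bd_array ((!) w) (entry A) (length A)"
    using border_length_eq_iff[of _ w] len by (auto simp: bd_array_def)
  moreover have "\<forall>x\<in>set A. 0 \<le> x" by (subst w) auto
  ultimately show "(\<forall>x\<in>set A. 0 \<le> x) \<and> valid (entry A) (length A)" using bd_array_imp_valid by blast
next
  assume v: "(\<forall>x\<in>set A. 0 \<le> x) \<and> valid (entry A) (length A)"
  then obtain f :: "nat \<Rightarrow> nat" where f: "bd_array f (entry A) (length A)" using valid_imp_bd_array by blast
  define w where "w = map f [0..<length A]"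
  have w: "bd_array ((!) w) (entry A) (length A)"
    using f bd_array_cong[of "length A" f "(!) w"] by (simp add: w_def)
  have "A = map (\<lambda>i. int (border_length w i)) [1..<Suc (length w)]"
  proof (rule nth_equalityI)
    show "length A = length (map (\<lambda>i. int (border_length w i)) [1..<Suc (length w)])"
      by (simp add: w_def del: upt_Suc)
    fix i assume i: "i < length A"
    have "border_length w (Suc i) = entry A (Suc i)"
      using w i border_length_eq_iff[of "Suc i" w "entry A (Suc i)"] by (simp add: bd_array_def w_def)
    then show "A ! i = map (\<lambda>i. int (border_length w i)) [1..<Suc (length w)] ! i"
      using i v by (simp add: entry_def w_def del: upt_Suc)
  qed
  then show "border_array A" unfolding border_array_def by blast
qed

lemma valid_iff_bd_array: "valid a N \<longleftrightarrow> (\<exists>w :: nat \<Rightarrow> nat. bd_array w a N)"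
  using valid_imp_bd_array bd_array_imp_valid by blast

text \<open>Passing through \<open>bd_array\<close>, which visibly reads only the entries
  \<open>1\<close> to \<open>N\<close>, avoids an induction over \<open>cand\<close>.\<close>

lemma valid_cong:
  assumes "\<And>m. 1 \<le> m \<Longrightarrow> m \<le> N \<Longrightarrow> a m = b m" shows "valid a N \<longleftrightarrow> valid b N"
  using assms by (auto simp: valid_iff_bd_array bd_array_def)

lemma valid_Suc:
  "valid a (Suc N) \<longleftrightarrow> valid a N \<and> (a (Suc N) = 0 \<or> a (Suc N) \<in> cand a (par a (Suc N)))"
  by (auto simp: valid_def le_Suc_eq)

section \<open>Constant-time ancestor queries in growing forests\<close>

text \<open>\<open>0\<close> stands for no node: it is the parent of the roots, and it is what
  zeroed memory contains.\<close>

locale rooted_forest =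
  fixes q dep :: "nat \<Rightarrow> nat"
  assumes q_0 [simp]: "q 0 = 0" and q_less: "0 < m \<Longrightarrow> q m < m"
    and dep_0 [simp]: "dep 0 = 0" and dep_Suc: "0 < m \<Longrightarrow> dep m = Suc (dep (q m))"
begin

definition chain :: "nat \<Rightarrow> nat \<Rightarrow> bool" where
  "chain m z \<longleftrightarrow> 0 < z \<and> (\<exists>e. z = (q ^^ e) m)"

lemma q_pow_0 [simp]: "(q ^^ e) 0 = 0"
  by (induction e) auto

lemma chain_0 [simp]: "\<not> chain 0 z" and not_chain_0 [simp]: "\<not> chain m 0"
  by (auto simp: chain_def)

lemma chain_iff: "0 < m \<Longrightarrow> chain m z \<longleftrightarrow> z = m \<or> chain (q m) z"
proof -
  assume m: "0 < m"
  have "(\<exists>e. z = (q ^^ e) m) \<longleftrightarrow> z = m \<or> (\<exists>e. z = (q ^^ e) (q m))"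
  proof
    assume "\<exists>e. z = (q ^^ e) m"
    then obtain e where "z = (q ^^ e) m" by blast
    then show "z = m \<or> (\<exists>e. z = (q ^^ e) (q m))"
      by (cases e) (auto simp: funpow_Suc_right simp del: funpow.simps(2))
  next
    have "z = m \<Longrightarrow> z = (q ^^ 0) m" "z = (q ^^ e) (q m) \<Longrightarrow> z = (q ^^ Suc e) m" for e
      by (auto simp: funpow_Suc_right simp del: funpow.simps(2))
    then show "z = m \<or> (\<exists>e. z = (q ^^ e) (q m)) \<Longrightarrow> \<exists>e. z = (q ^^ e) m" by blast
  qed
  then show ?thesis using m by (auto simp: chain_def)
qed

lemma chain_refl: "0 < m \<Longrightarrow> chain m m"
  by (simp add: chain_iff)

lemma chain_le: "chain m z \<Longrightarrow> z \<le> m"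
proof (induction m rule: less_induct)
  case (less m)
  then have "0 < m" by (auto intro: gr0I)
  with less q_less[of m] show ?case by (auto simp: chain_iff intro: less_imp_le dest: order_le_less_trans)
qed

lemma q_pow_le: "(q ^^ e) m \<le> m"
  using chain_le[of m "(q ^^ e) m"] by (cases "(q ^^ e) m = 0") (auto simp: chain_def)

lemma chain_trans: "chain m z \<Longrightarrow> chain z y \<Longrightarrow> chain m y"
  unfolding chain_def by (metis comp_apply funpow_add)

lemma chain_iff_level:
  "chain m z \<longleftrightarrow> 0 < z \<and> dep z \<le> dep m \<and> (q ^^ (dep m - dep z)) m = z"
proof (induction m rule: less_induct)
  case (less m)
  show ?case
  proof (cases "m = 0")
    case True then show ?thesis by auto
  next
    case False
    then have m: "0 < m" by simp
    have IH: "chain (q m) z \<longleftrightarrow> 0 < z \<and> dep z \<le> dep (q m) \<and> (q ^^ (dep (q m) - dep z)) (q m) = z"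
      using less q_less[OF m] by simp
    have d: "dep m = Suc (dep (q m))" using dep_Suc[OF m] .
    consider "dep z \<le> dep (q m)" | "dep z = dep m" | "dep z > dep m" using d by linarith
    then show ?thesis
    proof cases
      case 1
      then have "(q ^^ (dep m - dep z)) m = (q ^^ (dep (q m) - dep z)) (q m)"
        using d by (simp add: Suc_diff_le funpow_Suc_right del: funpow.simps)
      then show ?thesis using chain_iff[OF m, of z] IH 1 d by auto
    next
      case 2
      then show ?thesis using chain_iff[OF m, of z] IH d m by auto
    next
      case 3
      then show ?thesis using chain_iff[OF m, of z] IH d by auto
    qed
  qed
qed

lemma chain_inj: "chain m z \<Longrightarrow> chain m y \<Longrightarrow> dep z = dep y \<Longrightarrow> z = y"
  unfolding chain_iff_level by metis

lemma chain_q_iff_level: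
  "chain (q m) z \<longleftrightarrow> 0 < z \<and> dep z < dep m \<and> (q ^^ (dep m - dep z)) m = z"
proof (cases "m = 0")
  case True then show ?thesis by auto
next
  case False
  then have d: "dep m = Suc (dep (q m))" by (simp add: dep_Suc)
  then have "dep z \<le> dep (q m) \<Longrightarrow> (q ^^ (dep m - dep z)) m = (q ^^ (dep (q m) - dep z)) (q m)"
    by (simp add: Suc_diff_le funpow_Suc_right del: funpow.simps)
  then show ?thesis using d by (auto simp: chain_iff_level[of "q m"] less_Suc_eq_le)
qed

text \<open>The forest is cut into clusters, each a subtree named by its root \<open>c = cl c\<close>; a new node joins
  the cluster of its parent while that has fewer than \<open>2 * dep c\<close> members, and otherwise starts its
  own cluster. So clusters that have clusters below them are full. Inside a cluster, ancestors are
  recorded in the bit mask \<open>am\<close>, indexed by \<open>idx\<close>.\<close>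

definition members ::
  "nat \<Rightarrow> (nat \<Rightarrow> nat) \<Rightarrow> (nat \<Rightarrow> nat) \<Rightarrow> (nat \<Rightarrow> nat) \<Rightarrow> (nat \<Rightarrow> nat) \<Rightarrow> bool" where
  "members N cl idx am cnt \<longleftrightarrow>
     cl 0 = 0 \<and> cnt 0 = 0 \<and> (\<forall>m>N. cnt m = 0) \<and>
     (\<forall>m. 0 < m \<and> m \<le> N \<longrightarrow> chain m (cl m) \<and> cl (cl m) = cl m \<and> idx m < cnt (cl m) \<and>
        cnt m \<le> 2 * dep m \<and>
        (\<forall>k. bit (am m) k \<longrightarrow> k < cnt (cl m)) \<and>
        (\<forall>z. chain m z \<longrightarrow> cl z = cl m \<or> chain (q (cl m)) z) \<and>
        (cl m = m \<longrightarrow> q m = 0 \<or> cnt (cl (q m)) = 2 * dep (cl (q m))) \<and>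
        (\<forall>z. 0 < z \<and> z \<le> N \<and> cl z = cl m \<longrightarrow> (bit (am m) (idx z) \<longleftrightarrow> chain m z)))"

lemma membersD:
  assumes "members N cl idx am cnt" "0 < m" "m \<le> N"
  shows "chain m (cl m)" "cl (cl m) = cl m" "idx m < cnt (cl m)" "cnt m \<le> 2 * dep m"
    "\<And>k. bit (am m) k \<Longrightarrow> k < cnt (cl m)" "\<And>z. chain m z \<Longrightarrow> cl z = cl m \<or> chain (q (cl m)) z"
    "cl m = m \<Longrightarrow> q m = 0 \<or> cnt (cl (q m)) = 2 * dep (cl (q m))"
    "\<And>z. 0 < z \<Longrightarrow> z \<le> N \<Longrightarrow> cl z = cl m \<Longrightarrow> bit (am m) (idx z) \<longleftrightarrow> chain m z"
  using assms unfolding members_def by blast+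

lemma members_0:
  assumes "members N cl idx am cnt" shows "cl 0 = 0" "cnt 0 = 0" "N < m \<Longrightarrow> cnt m = 0"
  using assms unfolding members_def by blast+

lemma members_cl:
  assumes "members N cl idx am cnt" "0 < m" "m \<le> N" shows "0 < cl m" "cl m \<le> m" "dep (cl m) \<le> dep m"
proof -
  have c: "chain m (cl m)" by (rule membersD(1)[OF assms])
  show "0 < cl m" "dep (cl m) \<le> dep m" using c unfolding chain_iff_level by auto
  show "cl m \<le> m" using c by (rule chain_le)
qed

text \<open>The ancestors of the new node inside the cluster are those of its parent and itself. Its
  index is the old count, a bit that no older mask of the cluster has set, so the older masks stay
  correct.\<close>

lemma members_join:
  assumes inv: "members N cl idx am cnt" and c: "c = cl (q (Suc N))" "cnt c < 2 * dep c"
  shows "members (Suc N) (cl(Suc N := c)) (idx(Suc N := cnt c))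
    (am(Suc N := am (q (Suc N)) OR 2 ^ cnt c)) (cnt(c := Suc (cnt c)))"
proof -
  let ?i = "Suc N" let ?p = "q ?i"
  let ?cl = "cl(?i := c)" let ?idx = "idx(?i := cnt c)" let ?cnt = "cnt(c := Suc (cnt c))"
  let ?am = "am(?i := am ?p OR 2 ^ cnt c)"
  have pN: "?p \<le> N" using q_less[of ?i] by simp
  \<comment> \<open>As \<open>dep 0 = 0\<close>, a cluster with room is never the dummy one.\<close>
  have c0: "c \<noteq> 0" using c(2) by (auto intro: gr0I)
  then have p0: "0 < ?p" using c(1) members_0(1)[OF inv] by (auto intro: gr0I)
  note P = membersD[OF inv p0 pN, folded c(1)]
  have cN: "0 < c" "c \<le> N" using members_cl[OF inv p0 pN] c(1) pN by auto
  have ch_i: "chain ?i z \<longleftrightarrow> z = ?i \<or> chain ?p z" for z by (rule chain_iff) simp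
  have ci: "cl m \<noteq> ?i" "m \<noteq> ?i" if "0 < m" "m \<le> N" for m using members_cl[OF inv that] that by auto
  have old: "chain m z \<Longrightarrow> m \<le> N \<Longrightarrow> z \<le> N" for m z using chain_le[of m z] by simp
  show ?thesis unfolding members_def
  proof (intro conjI allI impI)
    show "?cl 0 = 0" "?cnt 0 = 0" using members_0[OF inv] c0 by auto
    show "?cnt m = 0" if "m > Suc N" for m using that members_0(3)[OF inv, of m] cN by auto
    fix m assume m: "0 < m \<and> m \<le> Suc N"
    note M = membersD[OF inv, of m]
    have C: "cl m \<noteq> ?i" if "m \<noteq> ?i" using ci[of m] m that by auto
    have q: "m \<le> N \<Longrightarrow> q m \<noteq> ?i" using q_less[of m] m by auto
    show "chain m (?cl m)" using M(1) m P(1) ch_i[of c] by (cases "m = ?i") simp_all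
    show "?cl (?cl m) = ?cl m" using M(2) m C P(2) cN by (cases "m = ?i") simp_all
    show "?idx m < ?cnt (?cl m)" using M(3) m C by (cases "m = ?i"; cases "cl m = c") simp_all
    show "?cnt m \<le> 2 * dep m" using M(4) m c(2) cN members_0(3)[OF inv, of ?i] by (auto simp: le_Suc_eq)
    show "k < ?cnt (?cl m)" if "bit (?am m) k" for k
      using that M(5)[of k] P(5)[of k] m C by (auto simp: bit_or_iff bit_exp_iff le_Suc_eq less_Suc_eq split: if_splits)
    show "?cl z = ?cl m \<or> chain (q (?cl m)) z" if "chain m z" for z
      using that M(6)[of z] P(6)[of z] ch_i[of z] m old[of m z] old[of ?p z] pN by (auto simp: le_Suc_eq)
    show "q m = 0 \<or> ?cnt (?cl (q m)) = 2 * dep (?cl (q m))" if "?cl m = m"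
      using that M(7) m q c(2) cN by (auto simp: le_Suc_eq split: if_splits)
    fix z assume z: "0 < z \<and> z \<le> Suc N \<and> ?cl z = ?cl m"
    show "bit (?am m) (?idx z) \<longleftrightarrow> chain m z"
    proof (cases "m = ?i"; cases "z = ?i")
      assume "m = ?i" "z = ?i"
      then show ?thesis using chain_refl by (simp add: bit_or_iff bit_exp_iff)
    next
      assume a: "m = ?i" "z \<noteq> ?i"
      then have zN: "0 < z" "z \<le> N" "cl z = c" using z by auto
      then have "idx z < cnt c" using membersD(3)[OF inv, of z] by simp
      then show ?thesis using a P(8)[of z] zN ch_i[of z] by (simp add: bit_or_iff bit_exp_iff)
    next
      assume a: "m \<noteq> ?i" "z = ?i"
      then have "\<not> chain m z" using chain_le[of m z] m by auto
      moreover have "\<not> bit (am m) (cnt c)" using M(5)[of "cnt c"] a m z by auto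
      ultimately show ?thesis using a by simp
    next
      assume a: "m \<noteq> ?i" "z \<noteq> ?i"
      then show ?thesis using M(8)[of z] z m by auto
    qed
  qed
qed

lemma members_new:
  assumes inv: "members N cl idx am cnt"
    and full: "\<not> cnt (cl (q (Suc N))) < 2 * dep (cl (q (Suc N)))"
  shows "members (Suc N) (cl(Suc N := Suc N)) (idx(Suc N := 0)) (am(Suc N := 1)) (cnt(Suc N := 1))"
proof -
  let ?i = "Suc N" let ?p = "q ?i"
  let ?cl = "cl(?i := ?i)" let ?idx = "idx(?i := 0)" let ?cnt = "cnt(?i := 1)"
  let ?am = "am(?i := 1)"
  have pN: "?p \<le> N" using q_less[of ?i] by simp
  have ch_i: "chain ?i z \<longleftrightarrow> z = ?i \<or> chain ?p z" for z by (rule chain_iff) simp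
  have old: "chain m z \<Longrightarrow> m \<le> N \<Longrightarrow> z \<le> N" for m z using chain_le[of m z] by simp
  \<comment> \<open>The invariant bounds each count by \<open>2 * dep\<close>, so a parent cluster
    that has no room has exactly this size.\<close>
  have fullp: "?p = 0 \<or> cnt (cl ?p) = 2 * dep (cl ?p) \<and> cl ?p \<noteq> ?i"
  proof (cases "?p = 0")
    case False
    then have "0 < cl ?p" "cl ?p \<le> N" using members_cl[OF inv, of ?p] pN by auto
    then show ?thesis using membersD(4)[OF inv, of "cl ?p"] full by auto
  qed simp
  show ?thesis unfolding members_def
  proof (intro conjI allI impI)
    show "?cl 0 = 0" "?cnt 0 = 0" using members_0[OF inv] by auto
    show "?cnt m = 0" if "m > Suc N" for m using that members_0(3)[OF inv, of m] by auto
    fix m assume m: "0 < m \<and> m \<le> Suc N"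
    note M = membersD[OF inv, of m]
    have C: "cl m \<noteq> ?i" if "m \<noteq> ?i" using members_cl[OF inv, of m] m that by auto
    have q: "m \<le> N \<Longrightarrow> q m \<le> N" using q_less[of m] m by auto
    have Cq: "m \<le> N \<Longrightarrow> q m \<noteq> 0 \<Longrightarrow> cl (q m) \<noteq> ?i" using members_cl[OF inv, of "q m"] q by auto
    show "chain m (?cl m)" using M(1) m chain_refl[of ?i] by (cases "m = ?i") simp_all
    show "?cl (?cl m) = ?cl m" using M(2) m C by (cases "m = ?i") simp_all
    show "?idx m < ?cnt (?cl m)" using M(3) m C by (cases "m = ?i") simp_all
    show "?cnt m \<le> 2 * dep m" using M(4) m dep_Suc[of ?i] by (cases "m = ?i") simp_all
    show "k < ?cnt (?cl m)" if "bit (?am m) k" for k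
      using that M(5)[of k] m C by (cases "m = ?i") (simp_all add: bit_1_iff bit_Suc_0_iff)
    show "?cl z = ?cl m \<or> chain (q (?cl m)) z" if "chain m z" for z
    proof (cases "m = ?i")
      case True
      then show ?thesis using that ch_i[of z] by auto
    next
      case False
      then have "m \<le> N" "z \<noteq> ?i" using m that old[of m z] by auto
      then show ?thesis using M(6)[of z] m that False by simp
    qed
    show "q m = 0 \<or> ?cnt (?cl (q m)) = 2 * dep (?cl (q m))" if "?cl m = m"
    proof (cases "m = ?i")
      case True
      moreover have "?p \<noteq> ?i" using pN by simp
      ultimately show ?thesis using fullp by (cases "?p = 0") simp_all
    next
      case False
      then have "m \<le> N" "cl m = m" using m that by auto
      moreover have "q m \<noteq> ?i" "q m \<noteq> 0 \<Longrightarrow> cl (q m) \<noteq> ?i" using q Cq \<open>m \<le> N\<close> by auto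
      ultimately show ?thesis using M(7) m by (cases "q m = 0") simp_all
    qed
    fix z assume z: "0 < z \<and> z \<le> Suc N \<and> ?cl z = ?cl m"
    have Cz: "cl z \<noteq> ?i" if "z \<noteq> ?i" using members_cl[OF inv, of z] z that by auto
    show "bit (?am m) (?idx z) \<longleftrightarrow> chain m z"
    proof (cases "m = ?i")
      case True
      then have "z = ?i" using z Cz by (cases "z = ?i") simp_all
      then show ?thesis using True chain_refl by (simp add: bit_Suc_0_iff)
    next
      case False
      then have "z \<noteq> ?i" using z C by (cases "z = ?i") simp_all
      then show ?thesis using M(8)[of z] z m False by simp
    qed
  qed
qed

text \<open>When a cluster has \<open>dep c\<close> members, it gets a table of that size; each further member fills one
  entry, so that the table lists all ancestors of \<open>c\<close> by the time the cluster is full.\<close>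

definition tables ::
  "nat \<Rightarrow> nat \<Rightarrow> (nat \<Rightarrow> nat) \<Rightarrow> (nat \<Rightarrow> nat) \<Rightarrow> (nat \<Rightarrow> nat) \<Rightarrow> (nat \<Rightarrow> nat) \<Rightarrow> bool" where
  "tables N B cnt bas wlk tb \<longleftrightarrow>
     (\<Sum>c = 1..N. cnt c) = N \<and> (\<Sum>c = 1..N. if dep c < cnt c then dep c else 0) = B \<and>
     (\<forall>c. 0 < c \<and> c \<le> N \<longrightarrow>
        (0 < cnt c \<longrightarrow> wlk c = (q ^^ (cnt c - dep c)) c) \<and>
        (dep c < cnt c \<longrightarrow> bas c + dep c \<le> B \<and> (\<forall>e<cnt c - dep c. tb (bas c + e) = (q ^^ e) c)) \<and>
        (\<forall>d. 0 < d \<and> d \<le> N \<and> d \<noteq> c \<and> dep c < cnt c \<and> dep d < cnt d \<longrightarrow>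
           bas c + dep c \<le> bas d \<or> bas d + dep d \<le> bas c))"

lemma tablesD:
  assumes "tables N B cnt bas wlk tb" "0 < c" "c \<le> N"
  shows "0 < cnt c \<Longrightarrow> wlk c = (q ^^ (cnt c - dep c)) c"
    "dep c < cnt c \<Longrightarrow> bas c + dep c \<le> B"
    "dep c < cnt c \<Longrightarrow> e < cnt c - dep c \<Longrightarrow> tb (bas c + e) = (q ^^ e) c"
    "dep c < cnt c \<Longrightarrow> 0 < d \<Longrightarrow> d \<le> N \<Longrightarrow> d \<noteq> c \<Longrightarrow> dep d < cnt d \<Longrightarrow>
      bas c + dep c \<le> bas d \<or> bas d + dep d \<le> bas c"
  using assms unfolding tables_def by blast+

text \<open>A table of \<open>dep c\<close> cells exists only for a cluster with more than
  \<open>dep c\<close> members, and the cluster sizes add up to \<open>N\<close>: this is the linear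
  space bound.\<close>

lemma tables_le: "tables N B cnt bas wlk tb \<Longrightarrow> B \<le> N"
proof -
  assume t: "tables N B cnt bas wlk tb"
  have "(\<Sum>c = 1..N. if dep c < cnt c then dep c else 0) \<le> (\<Sum>c = 1..N. cnt c)"
    by (intro sum_mono) auto
  then show ?thesis using t by (simp add: tables_def)
qed

lemma sum_upd:
  fixes f :: "nat \<Rightarrow> nat"
  assumes "0 < c" "c \<le> N" shows "(\<Sum>x = 1..N. (f(c := v)) x) + f c = (\<Sum>x = 1..N. f x) + v"
proof -
  have "(\<Sum>x = 1..N. (f(c := v)) x) = v + (\<Sum>x \<in> {1..N} - {c}. f x)"
    using assms by (subst sum.remove[of _ c]) (auto intro: sum.cong)
  moreover have "(\<Sum>x = 1..N. f x) = f c + (\<Sum>x \<in> {1..N} - {c}. f x)"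
    using assms by (subst sum.remove[of _ c]) auto
  ultimately show ?thesis by simp
qed

lemma tables_Suc:
  assumes "tables N B cnt bas wlk tb" "cnt (Suc N) = 0"
  shows "(\<Sum>c = 1..Suc N. cnt c) = N" "(\<Sum>c = 1..Suc N. if dep c < cnt c then dep c else 0) = B"
  using assms by (auto simp: tables_def)

lemma tables_new:
  assumes t: "tables N B cnt bas wlk tb" and z: "cnt (Suc N) = 0"
  shows "tables (Suc N) B (cnt(Suc N := 1)) bas (wlk(Suc N := Suc N)) tb"
proof -
  let ?cnt = "cnt(Suc N := 1)"
  note T = tablesD[OF t]
  \<comment> \<open>With one member and depth at least one, a new cluster does not own a table
    yet.\<close>
  have d: "1 \<le> dep (Suc N)" by (simp add: dep_Suc)
  have N: "c \<le> N" "dep c < cnt c" "?cnt c = cnt c" if "c \<le> Suc N" "dep c < ?cnt c" for c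
    using that d by (cases "c = Suc N"; simp)+
  have s1: "(\<Sum>c = 1..Suc N. ?cnt c) = Suc N"
    using sum_upd[of "Suc N" "Suc N" cnt 1] tables_Suc(1)[OF t z] z by linarith
  have "(\<Sum>c = 1..Suc N. if dep c < ?cnt c then dep c else 0)
      = (\<Sum>c = 1..Suc N. if dep c < cnt c then dep c else 0)"
    using d z by (intro sum.cong refl) auto
  then have s2: "(\<Sum>c = 1..Suc N. if dep c < ?cnt c then dep c else 0) = B"
    using tables_Suc(2)[OF t z] by linarith
  show ?thesis unfolding tables_def
  proof (intro conjI allI impI)
    fix c assume c: "0 < c \<and> c \<le> Suc N"
    show "(wlk(Suc N := Suc N)) c = (q ^^ (?cnt c - dep c)) c" if "0 < ?cnt c"
      using T(1)[of c] c that d by (cases "c = Suc N") auto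
    show "bas c + dep c \<le> B" if "dep c < ?cnt c"
      using T(2) N[OF _ that] c by blast
    show "tb (bas c + e) = (q ^^ e) c" if "dep c < ?cnt c" "e < ?cnt c - dep c" for e
      using T(3)[of c e] N[OF _ that(1)] c that(2) by simp
    fix d assume "0 < d \<and> d \<le> Suc N \<and> d \<noteq> c \<and> dep c < ?cnt c \<and> dep d < ?cnt d"
    then show "bas c + dep c \<le> bas d \<or> bas d + dep d \<le> bas c"
      using T(4) N c by blast
  qed (rule s1 s2)+
qed

lemma tables_join:
  assumes t: "tables N B cnt bas wlk tb" and z: "cnt (Suc N) = 0" and c: "0 < c" "c \<le> N" "0 < cnt c"
    and lt: "cnt c < dep c"
  shows "tables (Suc N) B (cnt(c := Suc (cnt c))) bas wlk tb"
proof -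
  let ?cnt = "cnt(c := Suc (cnt c))"
  note T = tablesD[OF t]
  have s1: "(\<Sum>x = 1..Suc N. ?cnt x) = Suc N"
    using sum_upd[of c "Suc N" cnt "Suc (cnt c)"] tables_Suc(1)[OF t z] c by linarith
  have "(\<Sum>x = 1..Suc N. if dep x < ?cnt x then dep x else 0)
      = (\<Sum>x = 1..Suc N. if dep x < cnt x then dep x else 0)"
    using lt by (intro sum.cong refl) auto
  then have s2: "(\<Sum>x = 1..Suc N. if dep x < ?cnt x then dep x else 0) = B"
    using tables_Suc(2)[OF t z] by linarith
  have N: "d \<le> N" "dep d < cnt d" "?cnt d = cnt d" if "d \<le> Suc N" "dep d < ?cnt d" for d
  proof -
    have "d \<noteq> c" using that lt by auto
    then show "dep d < cnt d" "?cnt d = cnt d" using that by auto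
    then have "d \<noteq> Suc N" using z by auto
    then show "d \<le> N" using that by simp
  qed
  show ?thesis unfolding tables_def
  proof (intro conjI allI impI)
    fix d assume d: "0 < d \<and> d \<le> Suc N"
    show "wlk d = (q ^^ (?cnt d - dep d)) d" if "0 < ?cnt d"
    proof (cases "d = c")
      case True
      then show ?thesis using T(1)[of c] c lt by simp
    next
      case False
      then have "0 < cnt d" "d \<noteq> Suc N" using that z by auto
      then show ?thesis using T(1)[of d] d False by simp
    qed
    show "bas d + dep d \<le> B" if "dep d < ?cnt d"
      using T(2) N[OF _ that] d by blast
    show "tb (bas d + e) = (q ^^ e) d" if "dep d < ?cnt d" "e < ?cnt d - dep d" for e
      using T(3)[of d e] N[OF _ that(1)] d that(2) by simp
    fix d' assume "0 < d' \<and> d' \<le> Suc N \<and> d' \<noteq> d \<and> dep d < ?cnt d \<and> dep d' < ?cnt d'"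
    then show "bas d + dep d \<le> bas d' \<or> bas d' + dep d' \<le> bas d"
      using T(4) N d by blast
  qed (rule s1 s2)+
qed

text \<open>The join that finds exactly \<open>dep c\<close> members allocates a block at the end
  \<open>B\<close>. This join and each later one write the ancestor held in \<open>wlk c\<close> and
  move \<open>wlk c\<close> one step up. The offset stays below \<open>dep c\<close>, so the
  disjoint blocks of other clusters are untouched.\<close>

lemma tables_join_fill:
  assumes t: "tables N B cnt bas wlk tb" and z: "cnt (Suc N) = 0" and c: "0 < c" "c \<le> N" "0 < cnt c"
    and ge: "dep c \<le> cnt c" "cnt c < 2 * dep c"
    and bd: "\<And>d. 0 < d \<Longrightarrow> d \<le> N \<Longrightarrow> cnt d \<le> 2 * dep d"
    and bas': "bas' = (if cnt c = dep c then bas(c := B) else bas)"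
    and B': "B' = (if cnt c = dep c then B + dep c else B)"
  shows "tables (Suc N) B' (cnt(c := Suc (cnt c))) bas' (wlk(c := q (wlk c)))
    (tb(bas' c + (cnt c - dep c) := wlk c))"
proof -
  let ?cnt = "cnt(c := Suc (cnt c))" let ?wlk = "wlk(c := q (wlk c))"
  let ?e = "cnt c - dep c"
  let ?tb = "tb(bas' c + ?e := wlk c)"
  note T = tablesD[OF t]
  have e: "?e < dep c" using ge by simp
  have N: "d \<le> N" if "d \<le> Suc N" "dep d < ?cnt d" for d
    using that z c by (cases "d = Suc N") auto
  have s1: "(\<Sum>x = 1..Suc N. ?cnt x) = Suc N"
    using sum_upd[of c "Suc N" cnt "Suc (cnt c)"] tables_Suc(1)[OF t z] c by linarith
  let ?f = "\<lambda>x. if dep x < cnt x then dep x else 0"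
  have "(\<Sum>x = 1..Suc N. if dep x < ?cnt x then dep x else 0) = (\<Sum>x = 1..Suc N. (?f(c := dep c)) x)"
    using ge by (intro sum.cong refl) auto
  moreover have "?f c = (if cnt c = dep c then 0 else dep c)" using ge by auto
  ultimately have upd: "(\<Sum>x = 1..Suc N. if dep x < ?cnt x then dep x else 0)
      + (if cnt c = dep c then 0 else dep c) = B + dep c"
    using sum_upd[of c "Suc N" ?f "dep c"] tables_Suc(2)[OF t z] c by linarith
  have s2: "(\<Sum>x = 1..Suc N. if dep x < ?cnt x then dep x else 0) = B'"
  proof (cases "cnt c = dep c")
    case True
    show ?thesis using upd unfolding B' if_P[OF True] by linarith
  next
    case False
    show ?thesis using upd unfolding B' if_not_P[OF False] by linarith
  qed
  have fit: "bas' d + dep d \<le> B'" if "0 < d" "d \<le> N" "dep d < ?cnt d" for d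
    using that T(2)[of d] ge by (auto simp: bas' B' split: if_splits)
  have dis: "bas' d + dep d \<le> bas' d' \<or> bas' d' + dep d' \<le> bas' d"
    if "0 < d" "d \<le> N" "dep d < ?cnt d" "0 < d'" "d' \<le> N" "dep d' < ?cnt d'" "d \<noteq> d'" for d d'
    using that T(2)[of d] T(2)[of d'] T(4)[of d d'] ge by (auto simp: bas' split: if_splits)
  show ?thesis unfolding tables_def
  proof (intro conjI allI impI)
    show "(\<Sum>x = 1..Suc N. ?cnt x) = Suc N" by (rule s1)
    show "(\<Sum>x = 1..Suc N. if dep x < ?cnt x then dep x else 0) = B'" by (rule s2)
    fix d assume d: "0 < d \<and> d \<le> Suc N"
    show "?wlk d = (q ^^ (?cnt d - dep d)) d" if "0 < ?cnt d"
    proof (cases "d = c")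
      case True
      then show ?thesis using T(1)[of c] c ge by (simp add: Suc_diff_le)
    next
      case False
      then have "d \<le> N" using d that z by (cases "d = Suc N") auto
      then show ?thesis using T(1)[of d] d that False by simp
    qed
    show "bas' d + dep d \<le> B'" if "dep d < ?cnt d" using fit N d that by blast
    show "?tb (bas' d + e') = (q ^^ e') d" if "dep d < ?cnt d" "e' < ?cnt d - dep d" for e'
    proof (cases "d = c")
      case True
      show ?thesis
      proof (cases "e' = ?e")
        case True then show ?thesis using \<open>d = c\<close> T(1)[of c] c by simp
      next
        case False
        then have "e' < ?e" using \<open>d = c\<close> that ge by auto
        then have "?tb (bas' d + e') = tb (bas' d + e')"
          by (intro fun_upd_other) (simp add: \<open>d = c\<close>)
        moreover have "dep c < cnt c" using \<open>e' < ?e\<close> by simp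
        ultimately show ?thesis using \<open>d = c\<close> T(3)[of c e'] c \<open>e' < ?e\<close> by (simp add: bas')
      qed
    next
      case False
      have dN: "d \<le> N" using N d that by blast
      have "bas' d + dep d \<le> bas' c \<or> bas' c + dep c \<le> bas' d"
        using dis[of d c] d dN that c ge False by auto
      \<comment> \<open>The bound \<open>cnt d \<le> 2 * dep d\<close> keeps the filled entries of
        \<open>d\<close> inside its own block.\<close>
      moreover have "e' < dep d" using bd[of d] d dN that False by auto
      ultimately have "bas' d + e' \<noteq> bas' c + ?e" using e by auto
      moreover have "bas' d = bas d" using False by (simp add: bas')
      moreover have "dep d < cnt d" "e' < cnt d - dep d" using that False by auto
      ultimately show ?thesis using T(3)[of d e'] d dN by simp
    qed
    fix d' assume "0 < d' \<and> d' \<le> Suc N \<and> d' \<noteq> d \<and> dep d < ?cnt d \<and> dep d' < ?cnt d'"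
    then show "bas' d + dep d \<le> bas' d' \<or> bas' d' + dep d' \<le> bas' d"
      using dis[of d d'] N[of d] N[of d'] d by auto
  qed
qed

section \<open>Answering ancestor queries\<close>

text \<open>An ancestor \<open>x\<close> outside the cluster of \<open>p\<close> lies above the root
  of this cluster, so \<open>p\<close> may be replaced by the parent \<open>r\<close> of that root.
  If \<open>r\<close> is a node, its cluster has a cluster below it and its table is complete,
  whereas the cluster of \<open>p\<close> may have no table at all.\<close>

definition lookup ::
  "(nat \<Rightarrow> nat) \<Rightarrow> (nat \<Rightarrow> nat) \<Rightarrow> (nat \<Rightarrow> nat) \<Rightarrow> (nat \<Rightarrow> nat) \<Rightarrow> (nat \<Rightarrow> nat) \<Rightarrow> nat \<Rightarrow> nat \<Rightarrow> bool" where
  "lookup cl idx am bas tb p x =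
    (let r = (if cl x = cl p then p else q (cl p)) in
     if cl x = cl r then bit (am r) (idx x)
     else dep x < dep (cl r) \<and> tb (bas (cl r) + (dep (cl r) - dep x)) = x)"

lemma full_root:
  assumes inv: "members N cl idx am cnt" and p: "p \<le> N" and r: "r = q (cl p)" "0 < r"
  shows "r \<le> N" "0 < cl r" "cl r \<le> N" "cnt (cl r) = 2 * dep (cl r)" "dep (cl r) < cnt (cl r)"
proof -
  have p0: "0 < p" using r members_0(1)[OF inv] by (cases "p = 0") auto
  note c = members_cl[OF inv p0 p]
  show rN: "r \<le> N" using q_less[of "cl p"] c r p by simp
  show cr: "0 < cl r" "cl r \<le> N" using members_cl[OF inv r(2) rN] rN by auto
  show f: "cnt (cl r) = 2 * dep (cl r)"
    using membersD(7)[OF inv, of "cl p"] membersD(2)[OF inv p0 p] c p r by simp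
  show "dep (cl r) < cnt (cl r)" using f dep_Suc[of "cl r"] cr by simp
qed

lemma lookup_iff_chain:
  assumes inv: "members N cl idx am cnt" and t: "tables N B cnt bas wlk tb"
    and p: "p \<le> N" and x: "0 < x" "x \<le> N"
  shows "lookup cl idx am bas tb p x \<longleftrightarrow> chain p x"
proof (cases "p = 0")
  case True
  then show ?thesis using members_0(1)[OF inv] members_cl[OF inv x] by (simp add: lookup_def)
next
  case False
  then have p0: "0 < p" by simp
  show ?thesis
  proof (cases "cl x = cl p")
    case True
    then show ?thesis using membersD(8)[OF inv p0 p x] by (simp add: lookup_def)
  next
    case c: False
    define r where "r = q (cl p)"
    have chp: "chain p x \<longleftrightarrow> chain r x"
    proof
      assume "chain p x" then show "chain r x" using membersD(6)[OF inv p0 p] c by (auto simp: r_def)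
    next
      assume "chain r x"
      then have "chain (cl p) x" using chain_iff[of "cl p"] members_cl[OF inv p0 p] by (simp add: r_def)
      then show "chain p x" using chain_trans membersD(1)[OF inv p0 p] by blast
    qed
    show ?thesis
    proof (cases "r = 0")
      case True
      then show ?thesis using chp c members_0(1)[OF inv] members_cl[OF inv x] by (simp add: lookup_def r_def)
    next
      case False
      then have r0: "0 < r" by simp
      note R = full_root[OF inv p r_def r0]
      show ?thesis
      proof (cases "cl x = cl r")
        case True
        then show ?thesis using chp c membersD(8)[OF inv r0 R(1) x] by (simp add: lookup_def r_def)
      next
        case cr: False
        have "chain r x \<longleftrightarrow> chain (q (cl r)) x"
        proof
          assume "chain r x" then show "chain (q (cl r)) x" using membersD(6)[OF inv r0 R(1)] cr by auto
        next
          assume "chain (q (cl r)) x"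
          then have "chain (cl r) x" using chain_iff[of "cl r"] R by simp
          then show "chain r x" using chain_trans membersD(1)[OF inv r0 R(1)] by blast
        qed
        also have "\<dots> \<longleftrightarrow> dep x < dep (cl r) \<and> (q ^^ (dep (cl r) - dep x)) (cl r) = x"
          using chain_q_iff_level x by simp
        also have "\<dots> \<longleftrightarrow> dep x < dep (cl r) \<and> tb (bas (cl r) + (dep (cl r) - dep x)) = x"
        proof -
          \<comment> \<open>Nodes have positive depth, so the distance is below
            \<open>dep (cl r)\<close>, the length of the completed table.\<close>
          have "0 < dep x" using x by (simp add: dep_Suc)
          then have "dep x < dep (cl r) \<Longrightarrow>
              tb (bas (cl r) + (dep (cl r) - dep x)) = (q ^^ (dep (cl r) - dep x)) (cl r)"
            using tablesD(3)[OF t R(2,3,5), of "dep (cl r) - dep x"] R(4) by simp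
          then show ?thesis by auto
        qed
        finally show ?thesis using chp c cr by (simp add: lookup_def r_def Let_def)
      qed
    qed
  qed
qed

end

interpretation forest: rooted_forest "jump a" "depth a" for a
  by unfold_locales (auto simp: jump_less depth_Suc)

section \<open>Candidates as bit masks over the jump chain\<close>

lemma cand_Suc:
  assumes "valid a N" "1 \<le> m" "m \<le> Suc N"
  shows "cand a m = insert m (cand a (par a m) - {a m})"
  using valid_par_less[OF assms] by (subst cand.simps) simp

lemma jump_eq:
  assumes "valid a N" "1 \<le> m" "m \<le> Suc N"
  shows "jump a m = (if a m = par a m then jump a (par a m) else par a m)"
  using valid_par_less[OF assms] by (subst jump.simps) simp

text \<open>Contraction loses no candidate: \<open>jump\<close> bypasses \<open>par a m\<close> only
  if \<open>a m = par a m\<close>, and then \<open>cand\<close> deletes this node too.\<close>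

lemma cand_imp_chain:
  assumes "valid a N" "m \<le> N" "z \<in> cand a m" shows "forest.chain a m z"
  using assms(2,3)
proof (induction m arbitrary: z rule: less_induct)
  case (less m)
  show ?case
  proof (cases "m = 0")
    case True then show ?thesis using less.prems by simp
  next
    case False
    then have m: "1 \<le> m" "m \<le> Suc N" "0 < m" using less.prems by auto
    let ?p = "par a m"
    have p: "?p < m" using valid_par_less[OF assms(1) m(1,2)] .
    have z: "z = m \<or> z \<in> cand a ?p \<and> z \<noteq> a m"
      using less.prems(2) cand_Suc[OF assms(1) m(1,2)] by auto
    have IH: "z \<in> cand a ?p \<Longrightarrow> forest.chain a ?p z" using less p by simp
    have "forest.chain a (jump a m) z" if "z \<in> cand a ?p" "z \<noteq> a m"
    proof (cases "a m = ?p")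
      case True
      have "0 < ?p" using that(1) by (cases "?p = 0") auto
      then show ?thesis
        using IH[OF that(1)] that(2) True forest.chain_iff[of ?p a z] jump_eq[OF assms(1) m(1,2)] by simp
    next
      case False
      then show ?thesis using IH[OF that(1)] jump_eq[OF assms(1) m(1,2)] by simp
    qed
    then show ?thesis using z forest.chain_iff[OF m(3)] by blast
  qed
qed

lemma cand_pos_le: "valid a N \<Longrightarrow> m \<le> N \<Longrightarrow> z \<in> cand a m \<Longrightarrow> 0 < z \<and> z \<le> m"
  using cand_imp_chain forest.chain_le by (metis forest.not_chain_0 gr0I)

text \<open>Depth is the right index for the bits: candidates lie on one chain, where the depth
  identifies a node, and it is logarithmic.\<close>

definition depth_mask :: "(nat \<Rightarrow> nat) \<Rightarrow> nat \<Rightarrow> nat \<Rightarrow> bool" where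
  "depth_mask a m v \<longleftrightarrow> (\<forall>d. bit v d \<longleftrightarrow> (\<exists>z\<in>cand a m. depth a z = d))"

lemma cand_iff_depth_mask:
  assumes "valid a N" "m \<le> N" "depth_mask a m v"
  shows "x \<in> cand a m \<longleftrightarrow> bit v (depth a x) \<and> forest.chain a m x"
  using assms(3) cand_imp_chain[OF assms(1,2)] forest.chain_inj[of a m]
  unfolding depth_mask_def by metis

text \<open>OR followed by XOR clears a bit whether or not it was set. For the entry
  \<open>0\<close> this is bit \<open>0\<close>, which no candidate occupies, so the program needs
  no case distinction.\<close>

lemma depth_mask_Suc:
  assumes "valid a (Suc N)" "depth_mask a (par a (Suc N)) v"
  shows "depth_mask a (Suc N)
    (((v OR 2 ^ depth a (a (Suc N))) XOR 2 ^ depth a (a (Suc N))) OR 2 ^ depth a (Suc N))"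
proof -
  let ?i = "Suc N" let ?p = "par a ?i"
  have v: "valid a N" and x: "a ?i = 0 \<or> a ?i \<in> cand a ?p" using assms(1) by (auto simp: valid_Suc)
  have p: "?p \<le> N" using valid_par_less[OF v, of ?i] by simp
  have uniq: "z = a ?i" if "z \<in> cand a ?p" "depth a z = depth a (a ?i)" for z
  proof (cases "a ?i = 0")
    case True
    then show ?thesis using that cand_pos_le[OF v p that(1)] depth_Suc[of z a] by simp
  next
    case False
    then show ?thesis
      using x that cand_imp_chain[OF v p] forest.chain_inj[of a ?p z "a ?i"] by simp
  qed
  have C: "cand a ?i = insert ?i (cand a ?p - {a ?i})" using cand_Suc[OF v, of ?i] by simp
  have "(\<exists>z\<in>cand a ?i. depth a z = d) \<longleftrightarrow>
      (\<exists>z\<in>cand a ?p. depth a z = d) \<and> d \<noteq> depth a (a ?i) \<or> d = depth a ?i" for d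
    unfolding C using uniq by (auto 0 3)
  then show ?thesis
    using assms(2) by (auto simp: depth_mask_def bit_or_iff bit_xor_iff bit_exp_iff)
qed

section \<open>Loop-free programs over arrays\<close>

text \<open>Without loops each compiled instruction runs at most once per activation, so the code
  length alone bounds the delay.\<close>

datatype com =
    Skip
  | Lit nat nat
  | Copy nat nat
  | Arith binop nat nat nat
  | Get nat nat nat
  | Put nat nat nat
  | Seq com com (infixr ";;" 60)
  | If_Eq nat nat com com
  | If_Less nat nat com com

text \<open>Serves as code length and as time bound. An array access spends four instructions on the
  address; a conditional adds its test and a jump over the other branch.\<close>

fun size_of :: "com \<Rightarrow> nat" where
  "size_of Skip = 0"
| "size_of (Lit d k) = 1"
| "size_of (Copy d a) = 1"
| "size_of (Arith f d a b) = 1"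
| "size_of (Get k d a) = 5"
| "size_of (Put k a b) = 5"
| "size_of (c1 ;; c2) = size_of c1 + size_of c2"
| "size_of (If_Eq a b c1 c2) = size_of c1 + size_of c2 + 2"
| "size_of (If_Less a b c1 c2) = size_of c1 + size_of c2 + 2"

text \<open>Interleaving the arrays lets all of them grow without knowing \<open>n\<close>; their
  cells with index below \<open>L\<close> occupy exactly the addresses below
  \<open>16 * L\<close>.\<close>

definition addr_code :: "nat \<Rightarrow> nat \<Rightarrow> instr list" where
  "addr_code k a = [Const 1 16, Op Mul 1 (2 * a) 1, Const 3 k, Op Add 1 1 3]"

text \<open>Variable \<open>x\<close> lives in register \<open>2 * x\<close>; registers \<open>1\<close> and \<open>3\<close> hold addresses. Cell \<open>i\<close> of
  array \<open>k < 16\<close> lives at address \<open>16 * i + k\<close>.\<close>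

fun compile :: "nat \<Rightarrow> com \<Rightarrow> program" where
  "compile p Skip = []"
| "compile p (Lit d k) = [Const (2 * d) k]"
| "compile p (Copy d a) = [Move (2 * d) (2 * a)]"
| "compile p (Arith f d a b) = [Op f (2 * d) (2 * a) (2 * b)]"
| "compile p (Get k d a) = addr_code k a @ [Load (2 * d) 1]"
| "compile p (Put k a b) = addr_code k a @ [Store 1 (2 * b)]"
| "compile p (c1 ;; c2) = compile p c1 @ compile (p + size_of c1) c2"
| "compile p (If_Eq a b c1 c2) =
     Jump_Eq (2 * a) (2 * b) (p + size_of c2 + 2) # compile (p + 1) c2 @
     Jump (p + size_of c1 + size_of c2 + 2) # compile (p + size_of c2 + 2) c1"
| "compile p (If_Less a b c1 c2) =
     Jump_Less (2 * a) (2 * b) (p + size_of c2 + 2) # compile (p + 1) c2 @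
     Jump (p + size_of c1 + size_of c2 + 2) # compile (p + size_of c2 + 2) c1"

lemma length_compile [simp]: "length (compile p c) = size_of c"
  by (induction c arbitrary: p) (auto simp: addr_code_def)

section \<open>Weakest preconditions and correctness of the compiler\<close>

type_synonym vars = "nat \<Rightarrow> nat"
type_synonym arrays = "nat \<Rightarrow> nat \<Rightarrow> nat"

text \<open>The index bound \<open>r a < L\<close> does double duty: with
  \<open>16 * L \<le> 2 ^ W\<close> the address cannot overflow, and every accessed address is below
  \<open>16 * L\<close>.\<close>

fun wp :: "nat \<Rightarrow> nat \<Rightarrow> com \<Rightarrow> (vars \<Rightarrow> arrays \<Rightarrow> bool) \<Rightarrow> vars \<Rightarrow> arrays \<Rightarrow> bool" where
  "wp W L Skip Q r M = Q r M"
| "wp W L (Lit d k) Q r M = Q (r(d := take_bit W k)) M"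
| "wp W L (Copy d a) Q r M = Q (r(d := r a)) M"
| "wp W L (Arith f d a b) Q r M = Q (r(d := apply_op W f (r a) (r b))) M"
| "wp W L (Get k d a) Q r M = (k < 16 \<and> r a < L \<and> Q (r(d := M k (r a))) M)"
| "wp W L (Put k a b) Q r M = (k < 16 \<and> r a < L \<and> Q r (M(k := (M k)(r a := r b))))"
| "wp W L (c1 ;; c2) Q r M = wp W L c1 (wp W L c2 Q) r M"
| "wp W L (If_Eq a b c1 c2) Q r M = (if r a = r b then wp W L c1 Q r M else wp W L c2 Q r M)"
| "wp W L (If_Less a b c1 c2) Q r M = (if r a < r b then wp W L c1 Q r M else wp W L c2 Q r M)"

lemma wp_mono:
  "wp W L c Q r M \<Longrightarrow> (\<And>r M. Q r M \<Longrightarrow> Q' r M) \<Longrightarrow> wp W L c Q' r M"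
proof (induction c arbitrary: Q Q' r M)
  case (Seq c1 c2)
  from Seq.prems(1) have "wp W L c1 (wp W L c2 Q) r M" by simp
  then show ?case using Seq.IH(1)[of "wp W L c2 Q" r M "wp W L c2 Q'"] Seq.IH(2) Seq.prems(2) by auto
qed (auto split: if_splits)

definition represents :: "ram_state \<Rightarrow> vars \<Rightarrow> arrays \<Rightarrow> bool" where
  "represents s r M \<longleftrightarrow> (\<forall>x. regs s (2 * x) = r x) \<and> (\<forall>k i. k < 16 \<longrightarrow> mem s (16 * i + k) = M k i)"

text \<open>The continuation-passing form: a terminating run from the exit of the fragment extends to one
  from its entry.\<close>

definition reaches ::
  "nat \<Rightarrow> program \<Rightarrow> ram_state \<Rightarrow> nat \<Rightarrow> nat set \<Rightarrow> ram_state \<Rightarrow> bool" where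
  "reaches W P s t X s' \<longleftrightarrow> (\<forall>u Y s''. run W P s' u Y s'' \<longrightarrow> run W P s (t + u) (X \<union> Y) s'')"

lemma reaches_refl: "reaches W P s 0 {} s"
  by (simp add: reaches_def)

lemma reaches_trans:
  "reaches W P s t X s' \<Longrightarrow> reaches W P s' u Y s'' \<Longrightarrow> reaches W P s (t + u) (X \<union> Y) s''"
  unfolding reaches_def by (metis add.assoc sup_assoc)

lemma reaches_step:
  assumes "pc s < length P" "reaches W P (exec W (P ! pc s) s) t X s'"
  shows "reaches W P s (Suc t) (accessed (P ! pc s) s \<union> X) s'"
  using assms run.step[of s P W] by (auto simp: reaches_def Un_assoc)

lemma reaches_one:
  assumes "pc s < length P" "P ! pc s = I"
  shows "reaches W P s 1 (accessed I s) (exec W I s)"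
  using reaches_step[OF assms(1) reaches_refl] assms(2) by simp

lemma addr_code_reaches:
  assumes P: "P = pre @ addr_code k a @ post" and pc: "pc s = length pre"
    and rep: "represents s r M" and k: "k < 16" and i: "16 * r a + 16 \<le> 2 ^ W" and W: "16 < (2::nat) ^ W"
  obtains s' where "reaches W P s 4 {} s'" "pc s' = length pre + 4" "represents s' r M"
    "regs s' 1 = 16 * r a + k" "mem s' = mem s"
proof -
  define s1 where "s1 = exec W (Const 1 16) s"
  define s2 where "s2 = exec W (Op Mul 1 (2 * a) 1) s1"
  define s3 where "s3 = exec W (Const 3 k) s2"
  define s4 where "s4 = exec W (Op Add 1 1 3) s3"
  note defs = s1_def s2_def s3_def s4_def
  have odd: "2 * x \<noteq> Suc 0" "2 * x \<noteq> 3" for x :: nat by presburger+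
  have lt: "16 * r a < 2 ^ W" "16 * r a + k < 2 ^ W" "k < 2 ^ W" using i k W by auto
  have 1: "reaches W P s 1 {} s1"
    using reaches_one[of s P "Const 1 16" W] by (simp add: P pc nth_append addr_code_def s1_def)
  have 2: "reaches W P s1 1 {} s2"
    using reaches_one[of s1 P "Op Mul 1 (2 * a) 1" W]
    by (simp add: P pc nth_append addr_code_def s1_def s2_def set_reg_def)
  have 3: "reaches W P s2 1 {} s3"
    using reaches_one[of s2 P "Const 3 k" W]
    by (simp add: P pc nth_append addr_code_def s1_def s2_def s3_def set_reg_def)
  have 4: "reaches W P s3 1 {} s4"
    using reaches_one[of s3 P "Op Add 1 1 3" W]
    by (simp add: P pc nth_append addr_code_def defs set_reg_def)
  show thesis
  proof
    show "reaches W P s 4 {} s4"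
      using reaches_trans[OF reaches_trans[OF reaches_trans[OF 1 2] 3] 4] by (simp add: eval_nat_numeral)
    show "represents s4 r M" using rep odd by (simp add: represents_def defs set_reg_def)
    show "regs s4 1 = 16 * r a + k"
      using rep lt W odd by (simp add: represents_def defs set_reg_def take_bit_nat_eq_self mult.commute)
  qed (simp_all add: defs set_reg_def pc)
qed

definition outcome ::
  "nat \<Rightarrow> program \<Rightarrow> nat \<Rightarrow> ram_state \<Rightarrow> nat \<Rightarrow> nat \<Rightarrow> (vars \<Rightarrow> arrays \<Rightarrow> bool) \<Rightarrow> bool" where
  "outcome W P b s n e Q \<longleftrightarrow> (\<exists>t X s' r M. reaches W P s t X s' \<and> t \<le> n \<and> X \<subseteq> {..<b} \<and>
     pc s' = e \<and> represents s' r M \<and> Q r M)"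

lemma outcomeI:
  "reaches W P s t X s' \<Longrightarrow> t \<le> n \<Longrightarrow> X \<subseteq> {..<b} \<Longrightarrow> pc s' = e \<Longrightarrow> represents s' r M \<Longrightarrow> Q r M \<Longrightarrow>
   outcome W P b s n e Q"
  unfolding outcome_def by blast

lemma outcome_reaches:
  assumes "reaches W P s t X s'" "X \<subseteq> {..<b}" "outcome W P b s' n e Q" "t + n \<le> m"
  shows "outcome W P b s m e Q"
proof -
  obtain u Y s'' r M where "reaches W P s' u Y s''" "u \<le> n" "Y \<subseteq> {..<b}" "pc s'' = e"
    "represents s'' r M" "Q r M" using assms(3) by (auto simp: outcome_def)
  then show ?thesis using reaches_trans[OF assms(1)] assms(2,4)
    by (intro outcomeI[where t = "t + u" and X = "X \<union> Y"]) auto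
qed

lemma outcome_bind:
  assumes "outcome W P b s n e Q"
    and "\<And>s' r M. pc s' = e \<Longrightarrow> represents s' r M \<Longrightarrow> Q r M \<Longrightarrow> outcome W P b s' n' e' Q'"
    and "n + n' \<le> m"
  shows "outcome W P b s m e' Q'"
proof -
  obtain t X s' r M where "reaches W P s t X s'" "t \<le> n" "X \<subseteq> {..<b}" "pc s' = e"
    "represents s' r M" "Q r M" using assms(1) by (auto simp: outcome_def)
  then show ?thesis using outcome_reaches[of W P s t X s' b n' e' Q' m] assms(2)[of s' r M] assms(3) by simp
qed

lemma outcome_one:
  assumes "pc s < length P" "P ! pc s = I" "accessed I s \<subseteq> {..<b}" "pc (exec W I s) = e"
    and "represents (exec W I s) r M" "Q r M"
  shows "outcome W P b s 1 e Q"
  by (rule outcomeI[OF reaches_one[OF assms(1,2)]]) (use assms in auto)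

lemma array_address_inj:
  assumes "k < 16" "l < 16" "16 * i + l = 16 * j + (k::nat)" shows "i = j \<and> l = k"
proof -
  have "i = (16 * i + l) div 16" "j = (16 * j + k) div 16" using assms(1,2) by simp_all
  then show ?thesis using assms(3) by simp
qed

text \<open>The test is abstracted to \<open>c\<close>, so that both kinds of conditional jump share
  one argument about the code layout, in which the else branch comes first.\<close>

lemma branch_outcome:
  assumes P: "P = pre @ I # compile (length pre + 1) c2 @
      Jump (length pre + size_of c1 + size_of c2 + 2) # compile (length pre + size_of c2 + 2) c1 @ post"
    and I: "exec W I s = branch c (length pre + size_of c2 + 2) s" "accessed I s = {}"
    and s: "pc s = length pre" "represents s r M"
    and IH1: "\<And>pre post s. c \<Longrightarrow> P = pre @ compile (length pre) c1 @ post \<Longrightarrow> pc s = length pre \<Longrightarrow>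
      represents s r M \<Longrightarrow> outcome W P b s (size_of c1) (length pre + size_of c1) Q"
    and IH2: "\<And>pre post s. \<not> c \<Longrightarrow> P = pre @ compile (length pre) c2 @ post \<Longrightarrow> pc s = length pre \<Longrightarrow>
      represents s r M \<Longrightarrow> outcome W P b s (size_of c2) (length pre + size_of c2) Q"
  shows "outcome W P b s (size_of c1 + size_of c2 + 2) (length pre + (size_of c1 + size_of c2 + 2)) Q"
proof -
  let ?s = "exec W I s"
  have 1: "reaches W P s 1 {} ?s" using reaches_one[of s P I W] I s by (simp add: P nth_append)
  have rep: "represents ?s r M" using s I by (simp add: represents_def branch_def)
  show ?thesis
  proof (cases c)
    case True
    let ?pre = "pre @ I # compile (length pre + 1) c2 @ [Jump (length pre + size_of c1 + size_of c2 + 2)]"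
    have "outcome W P b ?s (size_of c1) (length ?pre + size_of c1) Q"
      by (rule IH1[of ?pre post]) (use True I rep in \<open>simp_all add: P branch_def add_ac\<close>)
    from outcome_reaches[OF 1 _ this, of "size_of c1 + size_of c2 + 2"] show ?thesis by (simp add: add_ac)
  next
    case False
    let ?j = "Jump (length pre + size_of c1 + size_of c2 + 2)"
    let ?e = "length pre + 1 + size_of c2"
    let ?pre = "pre @ [I]"
    have 2: "outcome W P b ?s (size_of c2) ?e Q"
      using IH2[of ?pre "?j # compile (length pre + size_of c2 + 2) c1 @ post" ?s] False I rep s
      by (simp add: P branch_def)
    have 3: "outcome W P b s' 1 (length pre + (size_of c1 + size_of c2 + 2)) Q"
      if "pc s' = ?e" "represents s' r' M'" "Q r' M'" for s' r' M'
      by (rule outcome_one[where I = ?j and r = r' and M = M'])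
        (use that in \<open>simp_all add: P branch_def represents_def nth_append\<close>)
    have "outcome W P b ?s (size_of c2 + 1) (length pre + (size_of c1 + size_of c2 + 2)) Q"
      by (rule outcome_bind[OF 2 3]) auto
    from outcome_reaches[OF 1 _ this] show ?thesis by simp
  qed
qed

text \<open>Jump targets are absolute, so code is compiled for the place \<open>length pre\<close>
  where it stands in \<open>P\<close>; the induction therefore allows arbitrary code on both
  sides.\<close>

lemma compile_outcome:
  assumes "P = pre @ compile (length pre) c @ post" "pc s = length pre"
    and "represents s r M" "wp W L c Q r M" "16 * L \<le> 2 ^ W" "16 < (2::nat) ^ W"
  shows "outcome W P (16 * L) s (size_of c) (length pre + size_of c) Q"
  using assms(1-4)
proof (induction c arbitrary: Q pre post s r M)
  case Skip
  then show ?case using reaches_refl[of W P s] by (intro outcomeI) auto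
next
  case (Lit d k)
  show ?case unfolding size_of.simps
    by (intro outcome_one[where I = "Const (2 * d) k" and r = "r(d := take_bit W k)" and M = M])
       (use Lit in \<open>auto simp: represents_def set_reg_def nth_append fun_upd_def\<close>)
next
  case (Copy d a)
  show ?case unfolding size_of.simps
    by (intro outcome_one[where I = "Move (2 * d) (2 * a)" and r = "r(d := r a)" and M = M])
       (use Copy in \<open>auto simp: represents_def set_reg_def nth_append fun_upd_def\<close>)
next
  case (Arith f d a b)
  show ?case unfolding size_of.simps
    by (intro outcome_one[where I = "Op f (2 * d) (2 * a) (2 * b)" and
          r = "r(d := apply_op W f (r a) (r b))" and M = M])
       (use Arith in \<open>auto simp: represents_def set_reg_def nth_append fun_upd_def\<close>)
next
  case (Get k d a)
  have k: "k < 16" and a: "r a < L" and Q: "Q (r(d := M k (r a))) M" using Get by auto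
  have P: "P = pre @ addr_code k a @ Load (2 * d) 1 # post" using Get by simp
  obtain s' where s': "reaches W P s 4 {} s'" "pc s' = length pre + 4" "represents s' r M"
    "regs s' 1 = 16 * r a + k" "mem s' = mem s"
    using addr_code_reaches[OF P Get.prems(2,3) k _ assms(6)] a assms(5) by auto
  have "outcome W P (16 * L) s' 1 (length pre + 5) Q"
    by (rule outcome_one[where I = "Load (2 * d) 1" and r = "r(d := M k (r a))" and M = M])
      (use s' k a Q in \<open>auto simp: P nth_append addr_code_def represents_def set_reg_def fun_upd_def\<close>)
  then show ?case using outcome_reaches[OF s'(1)] by simp
next
  case (Put k a b)
  have k: "k < 16" and a: "r a < L" and Q: "Q r (M(k := (M k)(r a := r b)))" using Put by auto
  have P: "P = pre @ addr_code k a @ Store 1 (2 * b) # post" using Put by simp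
  obtain s' where s': "reaches W P s 4 {} s'" "pc s' = length pre + 4" "represents s' r M"
    "regs s' 1 = 16 * r a + k" "mem s' = mem s"
    using addr_code_reaches[OF P Put.prems(2,3) k _ assms(6)] a assms(5) by auto
  have "outcome W P (16 * L) s' 1 (length pre + 5) Q"
  proof (rule outcome_one[where I = "Store 1 (2 * b)" and r = r])
    show "represents (exec W (Store 1 (2 * b)) s') r (M(k := (M k)(r a := r b)))"
      using s' k by (auto simp: represents_def dest: array_address_inj)
  qed (use s' k a Q in \<open>auto simp: P nth_append addr_code_def\<close>)
  then show ?case using outcome_reaches[OF s'(1)] by simp
next
  case (Seq c1 c2)
  let ?pre = "pre @ compile (length pre) c1"
  have first: "outcome W P (16 * L) s (size_of c1) (length pre + size_of c1) (wp W L c2 Q)"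
    using Seq.IH(1)[of pre "compile (length pre + size_of c1) c2 @ post" s r M "wp W L c2 Q"]
      Seq.prems by simp
  have "outcome W P (16 * L) s' (size_of c2) (length pre + size_of (c1 ;; c2)) Q"
    if "pc s' = length pre + size_of c1" "represents s' r' M'" "wp W L c2 Q r' M'" for s' r' M'
    using Seq.IH(2)[of ?pre post s' r' M' Q] Seq.prems(1) that by (simp add: add.assoc)
  then show ?case by (rule outcome_bind[OF first]) simp_all
next
  case (If_Eq a b c1 c2)
  let ?I = "Jump_Eq (2 * a) (2 * b) (length pre + size_of c2 + 2)"
  have P: "P = pre @ ?I # compile (length pre + 1) c2 @
      Jump (length pre + size_of c1 + size_of c2 + 2) # compile (length pre + size_of c2 + 2) c1 @ post"
    using If_Eq.prems(1) by simp
  have I: "exec W ?I s = branch (r a = r b) (length pre + size_of c2 + 2) s" "accessed ?I s = {}"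
    using If_Eq.prems(3) by (auto simp: represents_def)
  have "outcome W P (16 * L) s (size_of c1 + size_of c2 + 2) (length pre + (size_of c1 + size_of c2 + 2)) Q"
  proof (rule branch_outcome[OF P I If_Eq.prems(2,3)])
    show "outcome W P (16 * L) s' (size_of c1) (length pre' + size_of c1) Q"
      if "r a = r b" "P = pre' @ compile (length pre') c1 @ post'" "pc s' = length pre'"
        "represents s' r M" for pre' post' s'
      using If_Eq.IH(1)[OF that(2-4)] If_Eq.prems(4) that(1) by simp
    show "outcome W P (16 * L) s' (size_of c2) (length pre' + size_of c2) Q"
      if "r a \<noteq> r b" "P = pre' @ compile (length pre') c2 @ post'" "pc s' = length pre'"
        "represents s' r M" for pre' post' s'
      using If_Eq.IH(2)[OF that(2-4)] If_Eq.prems(4) that(1) by simp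
  qed
  then show ?case by simp
next
  case (If_Less a b c1 c2)
  let ?I = "Jump_Less (2 * a) (2 * b) (length pre + size_of c2 + 2)"
  have P: "P = pre @ ?I # compile (length pre + 1) c2 @
      Jump (length pre + size_of c1 + size_of c2 + 2) # compile (length pre + size_of c2 + 2) c1 @ post"
    using If_Less.prems(1) by simp
  have I: "exec W ?I s = branch (r a < r b) (length pre + size_of c2 + 2) s" "accessed ?I s = {}"
    using If_Less.prems(3) by (auto simp: represents_def)
  have "outcome W P (16 * L) s (size_of c1 + size_of c2 + 2) (length pre + (size_of c1 + size_of c2 + 2)) Q"
  proof (rule branch_outcome[OF P I If_Less.prems(2,3)])
    show "outcome W P (16 * L) s' (size_of c1) (length pre' + size_of c1) Q"
      if "r a < r b" "P = pre' @ compile (length pre') c1 @ post'" "pc s' = length pre'"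
        "represents s' r M" for pre' post' s'
      using If_Less.IH(1)[OF that(2-4)] If_Less.prems(4) that(1) by simp
    show "outcome W P (16 * L) s' (size_of c2) (length pre' + size_of c2) Q"
      if "\<not> r a < r b" "P = pre' @ compile (length pre') c2 @ post'" "pc s' = length pre'"
        "represents s' r M" for pre' post' s'
      using If_Less.IH(2)[OF that(2-4)] If_Less.prems(4) that(1) by simp
  qed
  then show ?case by simp
qed

lemma compile_run:
  assumes "pc s = 0" "represents s r M" "wp W L c Q r M" "16 * L \<le> 2 ^ W" "16 < (2::nat) ^ W"
  obtains t X s' r' M' where "run W (compile 0 c) s t X s'" "t \<le> size_of c" "X \<subseteq> {..<16 * L}"
    "represents s' r' M'" "Q r' M'"
proof -
  have "outcome W (compile 0 c) (16 * L) s (size_of c) (size_of c) Q"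
    using compile_outcome[of "compile 0 c" "[]" c "[]" s r M W L Q] assms by simp
  then obtain t X s' r' M' where *: "reaches W (compile 0 c) s t X s'" "t \<le> size_of c"
    "X \<subseteq> {..<16 * L}" "pc s' = size_of c" "represents s' r' M'" "Q r' M'"
    by (auto simp: outcome_def)
  then have "run W (compile 0 c) s' 0 {} s'" by (intro run.halt) simp
  with *(1) have "run W (compile 0 c) s (t + 0) (X \<union> {}) s'" unfolding reaches_def by blast
  then have "run W (compile 0 c) s t X s'" by simp
  with * that show thesis by blast
qed

section \<open>Word arithmetic without overflow\<close>

lemma apply_op_Add: "x + y < 2 ^ W \<Longrightarrow> apply_op W Add x y = x + y"
  by (simp add: take_bit_nat_eq_self)

lemma apply_op_Sub: "y \<le> x \<Longrightarrow> x < 2 ^ W \<Longrightarrow> apply_op W Sub x y = x - y"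
proof -
  assume "y \<le> x" "x < 2 ^ W"
  then have "int x - int y = int (x - y)" "x - y < 2 ^ W" by auto
  then show ?thesis by (simp add: nat_take_bit_eq take_bit_nat_eq_self flip: of_nat_diff)
qed

lemma apply_op_Shl_one: "d < W \<Longrightarrow> apply_op W Shl (Suc 0) d = 2 ^ d"
proof -
  assume "d < W"
  then have "(2::nat) ^ d < 2 ^ W" by simp
  then show ?thesis by (simp add: push_bit_eq_mult take_bit_nat_eq_self)
qed

lemma test_bit_eq_0: "apply_op W And (apply_op W Shr v d) (Suc 0) = 0 \<longleftrightarrow> \<not> bit v d"
  by (simp add: bit_iff_odd_drop_bit and_one_eq[of "drop_bit d v", simplified] even_iff_mod_2_eq_zero)

lemma test_bit_pos: "0 < apply_op W And (apply_op W Shr v d) (Suc 0) \<longleftrightarrow> bit v d"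
  using test_bit_eq_0[of W v d] by auto

lemma apply_op_Or: "apply_op W Or x y = x OR y" and apply_op_Xor: "apply_op W Xor x y = x XOR y"
  by simp_all

declare apply_op.simps [simp del]

lemmas op_simps = apply_op_Add apply_op_Sub apply_op_Shl_one test_bit_eq_0 test_bit_pos apply_op_Or apply_op_Xor

section \<open>The validation program\<close>

abbreviation (input) "PAR \<equiv> 0 :: nat"
abbreviation (input) "JUMP \<equiv> 3 :: nat"
abbreviation (input) "DEPTH \<equiv> 2 :: nat"
abbreviation (input) "MASK \<equiv> 4 :: nat"
abbreviation (input) "CL \<equiv> 5 :: nat"
abbreviation (input) "IDX \<equiv> 6 :: nat"
abbreviation (input) "AM \<equiv> 7 :: nat"
abbreviation (input) "CNT \<equiv> 8 :: nat"
abbreviation (input) "BAS \<equiv> 9 :: nat"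
abbreviation (input) "WLK \<equiv> 10 :: nat"
abbreviation (input) "TAB \<equiv> 11 :: nat"

text \<open>Variables: 0 input and answer \<open>x\<close>, 1 number \<open>N\<close> of accepted values, 2 rejected flag,
  3 end of the allocated tables, 4 the constant one, 6 \<open>par a (Suc N)\<close>, 13 the constant zero,
  14 \<open>Suc N\<close>, 15 \<open>jump a (Suc N)\<close>, 16 \<open>depth a (Suc N)\<close>; all others are temporary.\<close>

definition check :: com where
  "check =
     Get DEPTH 7 0 ;; Get MASK 8 6 ;; Arith Shr 8 8 7 ;; Arith And 8 8 4 ;;
     If_Eq 8 13 (Lit 5 0)
       (Get CL 9 0 ;; Get CL 10 6 ;; Copy 11 6 ;;
        If_Eq 9 10 Skip (Get JUMP 11 10 ;; Get CL 10 11) ;;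
        If_Eq 9 10
          (Get IDX 8 0 ;; Get AM 5 11 ;; Arith Shr 5 5 8 ;; Arith And 5 5 4)
          (Get DEPTH 12 10 ;;
           If_Less 7 12
             (Arith Sub 12 12 7 ;; Get BAS 8 10 ;; Arith Add 8 8 12 ;; Get TAB 10 8 ;;
              If_Eq 10 0 (Lit 5 1) (Lit 5 0))
             (Lit 5 0)))"

definition extend_tree :: com where
  "extend_tree =
     If_Eq 0 6 (Get JUMP 15 6) (Copy 15 6) ;;
     Get DEPTH 16 15 ;; Arith Add 16 16 4 ;;
     Get MASK 8 6 ;; Get DEPTH 7 0 ;; Arith Shl 7 4 7 ;; Arith Or 8 8 7 ;; Arith Xor 8 8 7 ;;
     Arith Shl 7 4 16 ;; Arith Or 8 8 7 ;;
     Arith Add 17 14 4 ;; Arith Add 18 0 4 ;;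
     Put PAR 17 18 ;; Put JUMP 14 15 ;; Put DEPTH 14 16 ;; Put MASK 14 8"

definition fill_table :: com where
  "fill_table =
     If_Eq 19 12 (Put BAS 10 3 ;; Arith Add 3 3 12) Skip ;;
     Get BAS 8 10 ;; Arith Sub 7 19 12 ;; Arith Add 8 8 7 ;;
     Get WLK 7 10 ;; Put TAB 8 7 ;; Get JUMP 7 7 ;; Put WLK 10 7"

definition extend_clusters :: com where
  "extend_clusters =
     Get CL 10 15 ;; Get CNT 19 10 ;; Get DEPTH 12 10 ;; Arith Add 20 12 12 ;;
     If_Less 19 20
       (Put CL 14 10 ;; Put IDX 14 19 ;;
        Get AM 8 15 ;; Arith Shl 7 4 19 ;; Arith Or 8 8 7 ;; Put AM 14 8 ;;
        Arith Add 8 19 4 ;; Put CNT 10 8 ;;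
        If_Less 19 12 Skip fill_table)
       (Put CL 14 14 ;; Put IDX 14 13 ;; Put AM 14 4 ;; Put CNT 14 4 ;; Put WLK 14 14)"

text \<open>A word above \<open>N\<close> is rejected before it serves as an index; the same
  comparison catches negative inputs, which are large words in two's complement. The flag can stay
  set forever because prefixes of border arrays are border arrays.\<close>

definition validate :: com where
  "validate =
     Lit 4 1 ;; Lit 13 0 ;;
     If_Eq 2 13
       (Arith Add 14 1 4 ;;
        If_Less 0 14
          (Get PAR 6 14 ;;
           If_Eq 0 13 (Lit 5 1) check ;;
           If_Eq 5 13 (Lit 2 1 ;; Lit 0 0)
             (extend_tree ;; extend_clusters ;; Copy 1 14 ;; Lit 0 1))
          (Lit 2 1 ;; Lit 0 0))
       (Lit 0 0)"

section \<open>Correctness of one activation\<close>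

text \<open>\<open>PAR\<close> is one index ahead because the value at \<open>N\<close> already
  fixes the parent of \<open>Suc N\<close>.\<close>

definition invar :: "(nat \<Rightarrow> nat) \<Rightarrow> nat \<Rightarrow> nat \<Rightarrow> arrays \<Rightarrow> bool" where
  "invar a N B M \<longleftrightarrow>
     (\<forall>m\<le>Suc N. M PAR m = par a m) \<and>
     (\<forall>m\<le>N. M JUMP m = jump a m \<and> M DEPTH m = depth a m \<and> depth_mask a m (M MASK m)) \<and>
     forest.members a N (M CL) (M IDX) (M AM) (M CNT) \<and>
     forest.tables a N B (M CNT) (M BAS) (M WLK) (M TAB)"

text \<open>\<open>L = n + 2\<close> because accepting the value at \<open>n\<close> writes the
  parent of \<open>n + 1\<close>. A cluster has at most twice as many members as its root is deep,
  so \<open>2 * depth a m < W\<close> lets cluster masks, and all the more depth masks, fit into a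
  word.\<close>

locale word_size =
  fixes W L n :: nat and a :: "nat \<Rightarrow> nat"
  assumes L: "L = n + 2" "L < 2 ^ W" "3 < W"
    and W: "\<And>m. valid a m \<Longrightarrow> m \<le> n \<Longrightarrow> 2 * depth a m < W"
begin

lemma cl_le: "forest.members a N cl idx am cnt \<Longrightarrow> m \<le> N \<Longrightarrow> cl m \<le> N"
  using forest.members_cl[of a N cl idx am cnt m] forest.members_0(1)[of a N cl idx am cnt]
  by (cases "m = 0") auto

lemma wp_check:
  assumes inv: "invar a N B M" and v: "valid a N" and N: "N < n"
    and x: "0 < r 0" "r 0 \<le> N" and p: "r 6 \<le> N" and one: "r 4 = Suc 0" and zero: "r 13 = 0"
  shows "wp W L check (\<lambda>r' M'. M' = M \<and> (\<forall>y\<in>{0,1,2,3,4,6,13,14}. r' y = r y) \<and>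
    (r' 5 \<noteq> 0 \<longleftrightarrow> r 0 \<in> cand a (r 6))) r M"
proof -
  let ?x = "r 0" let ?p = "r 6" let ?cl = "M CL"
  have I: "M JUMP m = jump a m" "M DEPTH m = depth a m" "depth_mask a m (M MASK m)" if "m \<le> N" for m
    using inv that by (auto simp: invar_def)
  have mem: "forest.members a N (M CL) (M IDX) (M AM) (M CNT)"
    and tab: "forest.tables a N B (M CNT) (M BAS) (M WLK) (M TAB)"
    using inv by (auto simp: invar_def)
  \<comment> \<open>This is the node \<open>r\<close> of \<open>lookup\<close>; the program holds it
    in variable 11 and its cluster in variable 10.\<close>
  define s where "s = (if ?cl ?x = ?cl ?p then ?p else jump a (?cl ?p))"
  have le: "?cl ?x \<le> N" "?cl ?p \<le> N" using cl_le[OF mem] x p by auto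
  have j: "jump a m \<le> N" if "m \<le> N" for m
    using jump_less[of m a] that by (cases "m = 0") auto
  have s: "s \<le> N" using p j le by (simp add: s_def)
  have cs: "?cl s \<le> N" using cl_le[OF mem s] .
  have look: "forest.chain a ?p ?x \<longleftrightarrow> (if ?cl ?x = ?cl s then bit (M AM s) (M IDX ?x)
      else depth a ?x < depth a (?cl s) \<and>
        M TAB (M BAS (?cl s) + (depth a (?cl s) - depth a ?x)) = ?x)"
    by (simp add: forest.lookup_iff_chain[OF mem tab p x, symmetric] forest.lookup_def Let_def s_def)
  \<comment> \<open>The table lies within the \<open>B \<le> N\<close> allocated cells, so reading
    it respects the index bound of \<open>wp\<close>.\<close>
  have room: "M BAS (?cl s) + depth a (?cl s) \<le> N" if "?cl ?x \<noteq> ?cl s" "depth a ?x < depth a (?cl s)"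
  proof -
    have "?cl s \<noteq> 0" using that by (cases "?cl s = 0") auto
    then have s0: "0 < s" using forest.members_0(1)[OF mem] by (cases "s = 0") auto
    have s': "s = jump a (?cl ?p)" using that(1) by (auto simp: s_def split: if_splits)
    note R = forest.full_root[OF mem p s' s0]
    show ?thesis using forest.tablesD(2)[OF tab R(2,3,5)] forest.tables_le[OF tab] by simp
  qed
  have cand: "?x \<in> cand a ?p \<longleftrightarrow> bit (M MASK ?p) (depth a ?x) \<and> forest.chain a ?p ?x"
    by (rule cand_iff_depth_mask[OF v p I(3)[OF p]])
  have lt: "m < L" "m < 2 ^ W" if "m \<le> N" for m using that N L by auto
  have sub: "depth a (?cl s) < 2 ^ W" if "?cl ?x \<noteq> ?cl s" "depth a ?x < depth a (?cl s)"
    using lt(2)[OF room[OF that]] by simp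
  have "0 < W" using L(3) by simp
  note facts = x p one zero I(1,2) le j cs lt op_simps \<open>0 < W\<close>
  show ?thesis
  proof (cases "?cl ?x = ?cl ?p")
    case True
    then have "s = ?p" by (simp add: s_def)
    then show ?thesis using True by (simp add: check_def facts cand look)
  next
    case False
    then have s': "jump a (?cl ?p) = s" by (simp add: s_def)
    show ?thesis
    proof (cases "?cl ?x = ?cl s")
      case True
      then show ?thesis using False s s' by (simp add: check_def facts cand look)
    next
      case ne: False
      show ?thesis
      proof (cases "depth a ?x < depth a (?cl s)")
        case True
        have "M BAS (?cl s) + (depth a (?cl s) - depth a ?x) \<le> N" using room[OF ne True] by simp
        then show ?thesis using False ne True s s' sub[OF ne True] by (simp add: check_def facts cand look)
      next
        case False
        then show ?thesis using \<open>?cl ?x \<noteq> ?cl ?p\<close> ne s s' by (simp add: check_def facts cand look)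
      qed
    qed
  qed
qed

lemma wp_extend_tree:
  assumes inv: "invar a N B M" and v: "valid a (Suc N)" and N: "N < n"
    and r: "r 0 = a (Suc N)" "r 6 = par a (Suc N)" "r 4 = Suc 0" "r 14 = Suc N"
  shows "wp W L extend_tree (\<lambda>r' M'. (\<forall>y\<in>{0,1,2,3,4,13,14}. r' y = r y) \<and> r' 15 = jump a (Suc N) \<and>
    (\<forall>m\<le>Suc (Suc N). M' PAR m = par a m) \<and>
    (\<forall>m\<le>Suc N. M' JUMP m = jump a m \<and> M' DEPTH m = depth a m \<and> depth_mask a m (M' MASK m)) \<and>
    (\<forall>k>MASK. M' k = M k)) r M"
proof -
  let ?i = "Suc N"
  have v': "valid a N" using v by (simp add: valid_Suc)
  have I: "M JUMP m = jump a m" "M DEPTH m = depth a m" "depth_mask a m (M MASK m)" if "m \<le> N" for m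
    using inv that by (auto simp: invar_def)
  have P: "M PAR m = par a m" if "m \<le> Suc N" for m using inv that by (auto simp: invar_def)
  have x: "a ?i \<le> N" and p: "par a ?i \<le> N" using valid_less[OF v, of ?i] valid_par_less[OF v, of ?i] by auto
  have j: "jump a ?i = (if a ?i = par a ?i then jump a (par a ?i) else par a ?i)"
    by (rule jump_eq[OF v]) auto
  have jN: "jump a m \<le> N" if "m \<le> Suc N" for m
    using jump_less[of m a] that by (cases "m = 0") auto
  have d: "depth a ?i = Suc (depth a (jump a ?i))" by (simp add: depth_Suc)
  have W': "2 * depth a ?i < W" using W[OF v] N by simp
  \<comment> \<open>The accepted value is an earlier position or \<open>0\<close>; its depth is a
    shift distance and has to stay below \<open>W\<close>, too.\<close>
  have Wx: "2 * depth a (a ?i) < W" using W[of "a ?i"] v x N by (auto simp: valid_def)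
  have "W < 2 ^ W" by (rule less_exp)
  then have dW: "Suc (depth a (jump a ?i)) < 2 ^ W" using W' d by linarith
  have lt: "m < L" "m < 2 ^ W" if "m \<le> Suc (Suc N)" for m using that N L by auto
  have mask: "depth_mask a ?i (((M MASK (par a ?i) OR 2 ^ depth a (a ?i)) XOR 2 ^ depth a (a ?i)) OR 2 ^ depth a ?i)"
    by (rule depth_mask_Suc[OF v I(3)[OF p]])
  have jm: "jump a (par a ?i) \<le> N" "jump a ?i \<le> N" using jN[of "par a ?i"] jN[of ?i] p by auto
  note facts = r x p I(1,2) lt dW W' Wx jm d[symmetric] op_simps
  have A: "apply_op W Add (a ?i) (Suc 0) = Suc (a ?i)"
    "apply_op W Add (depth a (jump a ?i)) (Suc 0) = depth a ?i"
    using x lt[of "Suc (a ?i)"] dW d by (simp_all add: apply_op_Add)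
  have D: "depth a ?i < W" "depth a (a ?i) < W" using W' Wx by auto
  have sq: "m \<le> Suc (Suc N) \<longleftrightarrow> m = Suc (Suc N) \<or> m \<le> Suc N" "m \<le> Suc N \<longleftrightarrow> m = Suc N \<or> m \<le> N" for m by auto
  show ?thesis
  proof (cases "a ?i = par a ?i")
    case True
    then have "jump a (par a ?i) = jump a ?i" using j by simp
    then show ?thesis using True A D mask P I(3) by (simp add: extend_tree_def facts sq)
  next
    case False
    then have "jump a ?i = par a ?i" using j by simp
    then show ?thesis using False A D mask P I(3) by (simp add: extend_tree_def facts sq)
  qed
qed

lemma wp_extend_clusters:
  assumes mem: "forest.members a N (M CL) (M IDX) (M AM) (M CNT)"
    and tab: "forest.tables a N (r 3) (M CNT) (M BAS) (M WLK) (M TAB)"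
    and I: "\<And>m. m \<le> Suc N \<Longrightarrow> M JUMP m = jump a m \<and> M DEPTH m = depth a m"
    and v: "valid a (Suc N)" and N: "N < n"
    and r: "r 4 = Suc 0" "r 13 = 0" "r 14 = Suc N" "r 15 = jump a (Suc N)"
  shows "wp W L extend_clusters (\<lambda>r' M'. (\<forall>y\<in>{2,4,13,14}. r' y = r y) \<and> (\<forall>k\<le>MASK. M' k = M k) \<and>
    forest.members a (Suc N) (M' CL) (M' IDX) (M' AM) (M' CNT) \<and>
    forest.tables a (Suc N) (r' 3) (M' CNT) (M' BAS) (M' WLK) (M' TAB)) r M"
proof -
  let ?i = "Suc N"
  define q where "q = jump a ?i"
  define c where "c = M CL q"
  have q: "q \<le> N" using jump_less[of ?i a] by (simp add: q_def)
  have c: "c \<le> N" using cl_le[OF mem q] by (simp add: c_def)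
  have lt: "m < L" "m < 2 ^ W" if "m \<le> N" for m using that N L by auto
  have lti: "Suc N < L" "Suc N < 2 ^ W" using N L by auto
  have W': "2 * depth a c < W" using W[of c] v c N by (auto simp: valid_def)
  have WW: "W < 2 ^ W" by (rule less_exp)
  have I': "M DEPTH m = depth a m" "M JUMP m = jump a m" if "m \<le> N" for m
    using I that by auto
  have dbl: "apply_op W Add (depth a c) (depth a c) = 2 * depth a c"
  proof -
    have "depth a c + depth a c < 2 ^ W" using W' WW by linarith
    then show ?thesis by (simp add: apply_op_Add)
  qed
  have z: "M CNT ?i = 0" using forest.members_0(3)[OF mem, of ?i] by simp
  have B: "r 3 \<le> N" using forest.tables_le[OF tab] .
  note facts = r q c lt lti I' dbl op_simps q_def[symmetric] c_def[symmetric]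
  show ?thesis
  proof (cases "M CNT c < 2 * depth a c")
    case False
    note M' = forest.members_new[OF mem, folded q_def, folded c_def, OF False]
    note T' = forest.tables_new[OF tab z]
    show ?thesis using False M' T'
      by (simp add: extend_clusters_def facts)
  next
    case True
    have c0: "0 < c" using True by (cases "c = 0") auto
    have q0: "0 < q" using c0 forest.members_0(1)[OF mem] by (cases "q = 0") (auto simp: c_def)
    have cnt: "0 < M CNT c" using forest.membersD(3)[OF mem q0 q] by (simp add: c_def)
    note M' = forest.members_join[OF mem, of c, folded q_def, OF c_def True]
    have cW: "M CNT c < W" using True W' by simp
    then have "M CNT c + Suc 0 < 2 ^ W" using WW by linarith
    then have S: "apply_op W Add (M CNT c) (Suc 0) = Suc (M CNT c)" by (simp add: apply_op_Add)
    show ?thesis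
    proof (cases "M CNT c < depth a c")
      case lt1: True
      note T' = forest.tables_join[OF tab z c0 c cnt lt1]
      show ?thesis using True lt1 M' T'
        by (simp add: extend_clusters_def facts cW S)
    next
      case False
      then have ge: "depth a c \<le> M CNT c" by simp
      have "M CNT d \<le> 2 * depth a d" if "0 < d" "d \<le> N" for d
        using forest.membersD(4)[OF mem that] .
      note T' = forest.tables_join_fill[OF tab z c0 c cnt ge True this refl refl]
      have wlk: "M WLK c \<le> N"
        using forest.tablesD(1)[OF tab c0 c cnt] forest.q_pow_le[where a = a and m = c] c by (metis order_trans)
      have sub: "apply_op W Sub (M CNT c) (depth a c) = M CNT c - depth a c"
        by (rule apply_op_Sub[OF ge less_trans[OF cW WW]])
      show ?thesis
      proof (cases "M CNT c = depth a c")
        case eq: True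
        \<comment> \<open>The space bound for the state after the step shows that the allocation
          itself does not overflow.\<close>
        have "r 3 + depth a c \<le> Suc N" using forest.tables_le[OF T'] eq by simp
        then have add: "apply_op W Add (r 3) (depth a c) = r 3 + depth a c"
          using lti by (simp add: apply_op_Add)
        have add0: "apply_op W Add (r 3) 0 = r 3" using B lt by (simp add: apply_op_Add)
        show ?thesis using True eq M' T' sub cW S
          by (simp add: extend_clusters_def fill_table_def facts add add0 wlk B)
      next
        case ne: False
        then have gt: "depth a c < M CNT c" using ge by simp
        have "M BAS c + (M CNT c - depth a c) \<le> N"
          using forest.tablesD(2)[OF tab c0 c gt] B True by linarith
        then have idx: "M BAS c + (M CNT c - depth a c) < L"
          "apply_op W Add (M BAS c) (M CNT c - depth a c) = M BAS c + (M CNT c - depth a c)"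
          using lt by (simp_all only: apply_op_Add)
        show ?thesis using True False ne M' T' sub idx
          by (simp add: extend_clusters_def fill_table_def facts cW S wlk B)
      qed
    qed
  qed
qed

lemma wp_accept:
  assumes inv: "invar a N (r 3) M" and v: "valid a (Suc N)" and N: "N < n"
    and r: "r 0 = a (Suc N)" "r 6 = par a (Suc N)" "r 4 = Suc 0" "r 13 = 0" "r 14 = Suc N"
  shows "wp W L (extend_tree ;; extend_clusters ;; Copy 1 14 ;; Lit 0 1)
    (\<lambda>r' M'. r' 0 \<noteq> 0 \<and> r' 1 = Suc N \<and> r' 2 = r 2 \<and> invar a (Suc N) (r' 3) M') r M"
  unfolding wp.simps(7)
proof (rule wp_mono[OF wp_extend_tree[OF inv v N r(1,2,3,5)]])
  fix r' M'
  assume *: "(\<forall>y\<in>{0,1,2,3,4,13,14}. r' y = r y) \<and> r' 15 = jump a (Suc N) \<and>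
    (\<forall>m\<le>Suc (Suc N). M' PAR m = par a m) \<and>
    (\<forall>m\<le>Suc N. M' JUMP m = jump a m \<and> M' DEPTH m = depth a m \<and> depth_mask a m (M' MASK m)) \<and>
    (\<forall>k>MASK. M' k = M k)"
  have "forest.members a N (M' CL) (M' IDX) (M' AM) (M' CNT)"
    "forest.tables a N (r' 3) (M' CNT) (M' BAS) (M' WLK) (M' TAB)"
    using inv * by (auto simp: invar_def)
  then have "wp W L extend_clusters (\<lambda>r'' M''. (\<forall>y\<in>{2,4,13,14}. r'' y = r' y) \<and> (\<forall>k\<le>MASK. M'' k = M' k) \<and>
    forest.members a (Suc N) (M'' CL) (M'' IDX) (M'' AM) (M'' CNT) \<and>
    forest.tables a (Suc N) (r'' 3) (M'' CNT) (M'' BAS) (M'' WLK) (M'' TAB)) r' M'"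
    by (rule wp_extend_clusters) (use * v N r in auto)
  then show "wp W L extend_clusters (wp W L (Copy 1 14) (wp W L (Lit 0 1)
    (\<lambda>r' M'. r' 0 \<noteq> 0 \<and> r' 1 = Suc N \<and> r' 2 = r 2 \<and> invar a (Suc N) (r' 3) M'))) r' M'"
  proof (rule wp_mono)
    fix r'' M''
    assume **: "(\<forall>y\<in>{2,4,13,14}. r'' y = r' y) \<and> (\<forall>k\<le>MASK. M'' k = M' k) \<and>
      forest.members a (Suc N) (M'' CL) (M'' IDX) (M'' AM) (M'' CNT) \<and>
      forest.tables a (Suc N) (r'' 3) (M'' CNT) (M'' BAS) (M'' WLK) (M'' TAB)"
    have "invar a (Suc N) (r'' 3) M''" using * ** unfolding invar_def by simp
    moreover have "0 < W" using L(3) by simp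
    ultimately show "wp W L (Copy 1 14) (wp W L (Lit 0 1)
      (\<lambda>r' M'. r' 0 \<noteq> 0 \<and> r' 1 = Suc N \<and> r' 2 = r 2 \<and> invar a (Suc N) (r' 3) M')) r'' M''"
      using * ** r by simp
  qed
qed

text \<open>The input has to agree with \<open>a (Suc N)\<close> only if it is at most
  \<open>N\<close>: a negative value arrives as a large word, while \<open>entry\<close> makes it
  \<open>0\<close>.\<close>

lemma wp_validate:
  assumes ok: "r 2 = 0 \<Longrightarrow> r 1 = N \<and> valid a N \<and> invar a N (r 3) M" and N: "N < n"
    and x: "r 0 \<le> N \<Longrightarrow> r 0 = a (Suc N)"
  shows "wp W L validate (\<lambda>r' M'. if r 2 = 0 \<and> r 0 \<le> N \<and> valid a (Suc N)
    then r' 0 \<noteq> 0 \<and> r' 2 = 0 \<and> r' 1 = Suc N \<and> invar a (Suc N) (r' 3) M'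
    else r' 0 = 0 \<and> r' 2 \<noteq> 0) r M" (is "wp W L validate ?Q r M")
proof (cases "r 2 = 0 \<and> r 0 \<le> N")
  case False
  have W0: "0 < W" using L(3) by simp
  have "Suc N < 2 ^ W" using N L by simp
  show ?thesis
  proof (cases "r 2 = 0")
    case True
    then have "r 1 = N" "\<not> r 0 < Suc N" using ok False by auto
    then show ?thesis using True False W0 \<open>Suc N < 2 ^ W\<close> by (simp add: validate_def apply_op_Add)
  next
    case False
    then show ?thesis by (simp add: validate_def)
  qed
next
  case True
  have W0: "0 < W" using L(3) by simp
  have lt: "Suc N < 2 ^ W" "Suc N < L" using N L by auto
  have v: "valid a N" and inv: "invar a N (r 3) M" and r1: "r 1 = N" using ok True by auto
  have x': "r 0 = a (Suc N)" using x True by simp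
  let ?p = "par a (Suc N)"
  have p: "?p \<le> N" using valid_par_less[OF v, of "Suc N"] by simp
  have "M PAR (Suc N) = ?p" using inv by (simp add: invar_def)
  define r1 where "r1 = r(4 := Suc 0, 13 := 0, 14 := Suc N, 6 := ?p)"
  let ?c = "If_Eq 0 13 (Lit 5 1) check"
  let ?R = "\<lambda>r' M'. M' = M \<and> (\<forall>y\<in>{0,1,2,3,4,6,13,14}. r' y = r1 y) \<and>
    (r' 5 \<noteq> 0 \<longleftrightarrow> valid a (Suc N))"
  let ?d = "If_Eq 5 13 (Lit 2 1 ;; Lit 0 0) (extend_tree ;; extend_clusters ;; Copy 1 14 ;; Lit 0 1)"
  have "wp W L ?c ?R r1 M"
  proof (cases "r 0 = 0")
    case True
    then have "valid a (Suc N)" using v x' by (simp add: valid_Suc)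
    then show ?thesis using True W0 by (simp add: r1_def)
  next
    case False
    then have "wp W L check (\<lambda>r' M'. M' = M \<and> (\<forall>y\<in>{0,1,2,3,4,6,13,14}. r' y = r1 y) \<and>
        (r' 5 \<noteq> 0 \<longleftrightarrow> r1 0 \<in> cand a (r1 6))) r1 M"
      using True p by (intro wp_check[OF inv v N]) (auto simp: r1_def)
    moreover have "r1 0 \<in> cand a (r1 6) \<longleftrightarrow> valid a (Suc N)"
      using False v x' by (simp add: r1_def valid_Suc)
    ultimately show ?thesis using False by (simp add: r1_def)
  qed
  then have "wp W L ?c (wp W L ?d ?Q) r1 M"
  proof (rule wp_mono)
    fix r' M' assume R: "?R r' M'"
    show "wp W L ?d ?Q r' M'"
    proof (cases "valid a (Suc N)")
      case False
      then show ?thesis using R W0 by (simp add: r1_def)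
    next
      case v': True
      have "wp W L (extend_tree ;; extend_clusters ;; Copy 1 14 ;; Lit 0 1)
        (\<lambda>r'' M''. r'' 0 \<noteq> 0 \<and> r'' 1 = Suc N \<and> r'' 2 = r' 2 \<and> invar a (Suc N) (r'' 3) M'') r' M'"
        using R inv x' by (intro wp_accept[OF _ v' N]) (auto simp: r1_def)
      then have "wp W L (extend_tree ;; extend_clusters ;; Copy 1 14 ;; Lit 0 1) ?Q r' M'"
        by (rule wp_mono) (use R True v' in \<open>auto simp: r1_def\<close>)
      then show ?thesis using R v' by (simp add: r1_def del: wp.simps(7))
    qed
  qed
  then show ?thesis
    using True r1 \<open>M PAR (Suc N) = ?p\<close> lt W0
    by (simp add: validate_def apply_op_Add r1_def[symmetric] fun_upd_twist)
qed

end

section \<open>Initial state, word size and the whole run\<close>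

text \<open>Zeroed memory already is the structure for the empty array, so no initialization delays
  the first value.\<close>

lemma invar_initial: "invar a 0 0 (\<lambda>_ _. 0)"
proof -
  have "par a m = 0" if "m \<le> Suc 0" for m using that by (cases "(a, m)" rule: par.cases) auto
  then show ?thesis
    by (auto simp: invar_def depth_mask_def forest.members_def forest.tables_def)
qed

lemma border_array_take_iff:
  assumes "i \<le> length A"
  shows "border_array (take i A) \<longleftrightarrow> (\<forall>j<i. 0 \<le> A ! j) \<and> valid (entry A) i"
proof -
  have "valid (entry (take i A)) i \<longleftrightarrow> valid (entry A) i"
    by (rule valid_cong) (auto simp: entry_def)
  moreover have "(\<forall>x\<in>set (take i A). 0 \<le> x) \<longleftrightarrow> (\<forall>j<i. 0 \<le> A ! j)"
    using assms by (auto simp: set_conv_nth)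
  ultimately show ?thesis using assms by (simp add: border_array_iff_valid min_absorb2)
qed

lemma to_word_eq:
  assumes "fits_word W x"
  shows "0 \<le> x \<Longrightarrow> to_word W x = nat x" "x < 0 \<Longrightarrow> 2 ^ (W - 1) \<le> to_word W x"
proof -
  from assms have W: "0 < W" and lo: "- (2 ^ (W - 1)) \<le> x" and hi: "x < 2 ^ (W - 1)"
    by (auto simp: fits_word_def)
  have p: "(2::int) ^ W = 2 * 2 ^ (W - 1)" using W by (simp flip: power_Suc)
  show "to_word W x = nat x" if "0 \<le> x"
  proof -
    have "x < 2 ^ W" using hi that p by linarith
    then show ?thesis using that by (simp add: to_word_def take_bit_int_eq_self)
  qed
  show "2 ^ (W - 1) \<le> to_word W x" if "x < 0"
  proof -
    have "x mod 2 ^ W = (x + 2 ^ W) mod 2 ^ W" by simp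
    also have "\<dots> = x + 2 ^ W" using lo that p by (intro mod_pos_pos_trivial) linarith+
    finally have "int (2 ^ (W - 1)) \<le> take_bit W x" using lo p by (simp add: take_bit_eq_mod)
    then show ?thesis unfolding to_word_def by linarith
  qed
qed

lemma word_size_bound:
  assumes n: "1 \<le> n" and W: "8 * (log 2 (real n) + 1) \<le> real W"
  shows "(2 * n) ^ 8 \<le> 2 ^ W"
proof -
  have "log 2 (real (2 * n) ^ 8) = 8 * log 2 (real (2 * n))"
    using n by (subst log_nat_power) auto
  also have "log 2 (real (2 * n)) = log 2 (real n) + 1"
    using n by (simp add: log_mult)
  finally have "log 2 (real (2 * n) ^ 8) \<le> real W" using W by simp
  then have "real (2 * n) ^ 8 \<le> 2 powr real W"
    using n by (subst (asm) log_le_iff) auto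
  then have "real ((2 * n) ^ 8) \<le> real (2 ^ W)" by (simp add: powr_realpow)
  then show ?thesis by (simp only: of_nat_le_iff)
qed

text \<open>\<open>depth_bound\<close> yields \<open>2 ^ (2 * depth a m) \<le> (2 * n) ^ 4\<close>.
  The rest of the eighth power makes this strict and leaves room for the addresses, even at
  \<open>n = 1\<close>.\<close>

lemma word_size_intro:
  assumes n: "1 \<le> n" and W: "(2 * n) ^ 8 \<le> (2::nat) ^ W"
  shows "word_size W (n + 2) n a" "16 * (n + 2) \<le> 2 ^ W" "16 < (2::nat) ^ W" "3 < W"
proof -
  have "(2::nat) ^ 7 \<le> (2 * n) ^ 7" using n by (intro power_mono) auto
  then have "2 * n * 2 ^ 7 \<le> 2 * n * (2 * n) ^ 7" by (rule mult_le_mono2)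
  also have "\<dots> = (2 * n) ^ 8" by (simp add: eval_nat_numeral)
  finally have big: "256 * n \<le> 2 ^ W" using W by simp
  have "16 * (n + 2) \<le> 256 * n" using n by simp
  then show 16: "16 * (n + 2) \<le> 2 ^ W" using big by (rule order_trans)
  have "16 < 16 * (n + 2)" by simp
  then show 17: "16 < (2::nat) ^ W" using 16 by (rule less_le_trans)
  then have "(2::nat) ^ 4 < 2 ^ W" by simp
  then show W3: "3 < W" by (subst (asm) power_strict_increasing_iff) auto
  have "2 * depth a m < W" if v: "valid a m" and m: "m \<le> n" for m
  proof (cases "m = 0")
    case True then show ?thesis using W3 by simp
  next
    case False
    then have "2 ^ depth a m \<le> (2 * m)\<^sup>2" using depth_bound[OF v, of m] by simp
    also have "\<dots> \<le> (2 * n)\<^sup>2" using m by (intro power_mono) auto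
    finally have "(2 ^ depth a m)\<^sup>2 \<le> ((2 * n)\<^sup>2)\<^sup>2" by (intro power_mono) auto
    then have "2 ^ (2 * depth a m) \<le> (2 * n) ^ 4" by (simp add: power_mult[symmetric] mult.commute)
    also have "\<dots> < (2 * n) ^ 8" using n by (intro power_strict_increasing) auto
    also note W
    finally show ?thesis by (subst (asm) power_strict_increasing_iff) auto
  qed
  then show "word_size W (n + 2) n a" using 16 17 W3 by unfold_locales auto
qed

text \<open>After a rejection nothing is claimed about the memory: the flag alone determines all
  later answers.\<close>

definition status :: "int list \<Rightarrow> nat \<Rightarrow> vars \<Rightarrow> arrays \<Rightarrow> bool" where
  "status A i r M \<longleftrightarrow> (if border_array (take i A)
     then r 2 = 0 \<and> r 1 = i \<and> invar (entry A) i (r 3) M else r 2 \<noteq> 0)"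

lemma run_validate:
  assumes n: "length A = n" "1 \<le> n" and W: "(2 * n) ^ 8 \<le> (2::nat) ^ W"
    and i: "i < n" and fit: "fits_word W (A ! i)"
    and rep: "represents s r M" and st: "status A i r M"
  obtains t X s' r' M' where "run W (compile 0 validate) (receive W (A ! i) s) t X s'"
    "t \<le> size_of validate" "X \<subseteq> {..<16 * (n + 2)}" "represents s' r' M'"
    "status A (Suc i) r' M'" "regs s' 0 \<noteq> 0 \<longleftrightarrow> border_array (take (Suc i) A)"
proof -
  let ?a = "entry A" let ?x = "A ! i" let ?r = "r(0 := to_word W ?x)"
  note ws = word_size_intro[OF n(2) W]
  interpret word_size W "n + 2" n ?a by (rule ws)
  have B: "border_array (take j A) \<longleftrightarrow> (\<forall>k<j. 0 \<le> A ! k) \<and> valid ?a j" if "j \<le> n" for j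
    using border_array_take_iff that n by simp
  \<comment> \<open>A word up to \<open>i\<close> cannot encode a negative value, as those start at
    \<open>2 ^ (W - 1) > n\<close>.\<close>
  have x: "0 \<le> ?x \<and> to_word W ?x = ?a (Suc i)" if "to_word W ?x \<le> i"
  proof -
    have "(2::nat) ^ W = 2 * 2 ^ (W - 1)" using ws(4) by (simp flip: power_Suc)
    moreover have "2 * n < 2 ^ W" by (rule less_le_trans[OF _ ws(2)]) simp
    ultimately have "n < 2 ^ (W - 1)" by simp
    then have "0 \<le> ?x" using to_word_eq(2)[OF fit] that i by linarith
    then show ?thesis using to_word_eq(1)[OF fit] by (simp add: entry_def)
  qed
  have iff: "r 2 = 0 \<and> to_word W ?x \<le> i \<and> valid ?a (Suc i) \<longleftrightarrow> border_array (take (Suc i) A)"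
  proof
    assume *: "r 2 = 0 \<and> to_word W ?x \<le> i \<and> valid ?a (Suc i)"
    then have "border_array (take i A)" using st by (auto simp: status_def split: if_splits)
    then show "border_array (take (Suc i) A)" using * x B[of i] B[of "Suc i"] i by (auto simp: less_Suc_eq)
  next
    assume "border_array (take (Suc i) A)"
    then have *: "\<forall>k<Suc i. 0 \<le> A ! k" "valid ?a (Suc i)" using B[of "Suc i"] i by auto
    then have "border_array (take i A)" using B[of i] i by (simp add: valid_Suc)
    then have "r 2 = 0" using st by (simp add: status_def)
    moreover have "to_word W ?x = ?a (Suc i)" using to_word_eq(1)[OF fit] * by (simp add: entry_def)
    moreover have "?a (Suc i) \<le> i" using valid_less[OF *(2), of "Suc i"] by simp
    ultimately show "r 2 = 0 \<and> to_word W ?x \<le> i \<and> valid ?a (Suc i)" using * by simp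
  qed
  have "wp W (n + 2) validate (\<lambda>r' M'. if ?r 2 = 0 \<and> ?r 0 \<le> i \<and> valid ?a (Suc i)
    then r' 0 \<noteq> 0 \<and> r' 2 = 0 \<and> r' 1 = Suc i \<and> invar ?a (Suc i) (r' 3) M'
    else r' 0 = 0 \<and> r' 2 \<noteq> 0) ?r M"
    by (rule wp_validate)
      (use st x B[of i] i in \<open>auto simp: status_def split: if_splits\<close>)
  then have "wp W (n + 2) validate
      (\<lambda>r' M'. status A (Suc i) r' M' \<and> (r' 0 \<noteq> 0 \<longleftrightarrow> border_array (take (Suc i) A))) ?r M"
    by (rule wp_mono) (use iff in \<open>auto simp: status_def split: if_splits\<close>)
  moreover have "represents (receive W ?x s) ?r M" "pc (receive W ?x s) = 0"
    using rep by (auto simp: represents_def receive_def)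
  ultimately show thesis
    using compile_run[of "receive W ?x s" ?r M W "n + 2" validate] ws(2,3) that
    by (smt (verit) mult_0_right represents_def)
qed

text \<open>\<open>online_run\<close> consumes the list from the front, so the induction goes from
  the empty rest at \<open>i = n\<close> downwards, for all states that represent the status after
  \<open>i\<close> values.\<close>

lemma online_run_validate:
  assumes n: "length A = n" "1 \<le> n" and W: "(2 * n) ^ 8 \<le> (2::nat) ^ W"
    and fit: "\<forall>x\<in>set A. fits_word W x"
    and "i \<le> n" "represents s r M" "status A i r M"
  shows "\<exists>ts X. online_run W (compile 0 validate) s (drop i A)
      (map (\<lambda>j. border_array (take j A)) [Suc i..<Suc n]) ts X \<and>
    length ts = n - i \<and> (\<forall>t\<in>set ts. t \<le> size_of validate) \<and> X \<subseteq> {..<16 * (n + 2)}"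
  using assms(5-7)
proof (induction i arbitrary: s r M rule: inc_induct)
  case base
  then show ?case using n by (intro exI[of _ "[]"] exI[of _ "{}"]) (auto intro: online_run.finish)
next
  case (step i)
  have "fits_word W (A ! i)" using fit step.hyps n by simp
  then obtain t X s' r' M' where 1: "run W (compile 0 validate) (receive W (A ! i) s) t X s'"
    "t \<le> size_of validate" "X \<subseteq> {..<16 * (n + 2)}" "represents s' r' M'"
    "status A (Suc i) r' M'" "regs s' 0 \<noteq> 0 \<longleftrightarrow> border_array (take (Suc i) A)"
    using run_validate[OF n W _ _ step.prems] step.hyps by blast
  obtain ts Y where 2: "online_run W (compile 0 validate) s' (drop (Suc i) A)
      (map (\<lambda>j. border_array (take j A)) [Suc (Suc i)..<Suc n]) ts Y"
    "length ts = n - Suc i" "\<forall>t\<in>set ts. t \<le> size_of validate" "Y \<subseteq> {..<16 * (n + 2)}"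
    using step.IH[OF 1(4,5)] by blast
  have "drop i A = A ! i # drop (Suc i) A" using step.hyps n by (simp add: Cons_nth_drop_Suc)
  moreover have "[Suc i..<Suc n] = Suc i # [Suc (Suc i)..<Suc n]" using step.hyps by (simp add: upt_conv_Cons)
  ultimately have "online_run W (compile 0 validate) s (drop i A)
      (map (\<lambda>j. border_array (take j A)) [Suc i..<Suc n]) (t # ts) (X \<union> Y)"
    using online_run.input[OF 1(1) 2(1)] 1(6) by (simp del: upt_Suc)
  then show ?case using 1 2 step.hyps by (intro exI[of _ "t # ts"] exI[of _ "X \<union> Y"]) auto
qed

theorem theorem1:
  "\<exists>(P :: program) (K :: nat) (C :: nat). \<forall>wl :: nat \<Rightarrow> nat.
     (\<lambda>n. real (wl n)) \<in> \<Theta>(\<lambda>n. log 2 (real n)) \<longrightarrow>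
     (\<forall>n\<ge>1. real K * (log 2 (real n) + 1) \<le> real (wl n)) \<longrightarrow>
     (\<forall>(n :: nat) (A :: int list).
        n \<ge> 1 \<longrightarrow> length A = n \<longrightarrow> (\<forall>x\<in>set A. fits_word (wl n) x) \<longrightarrow>
        (\<exists>answers times addresses.
           online_run (wl n) P initial A answers times addresses \<and>
           answers = map (\<lambda>i. border_array (take i A)) [1..<Suc n] \<and>
           (\<forall>t\<in>set times. t \<le> C) \<and>
           sum_list times \<le> C * n \<and>
           addresses \<subseteq> {..<C * n}))"
\<comment> \<open>\<open>8\<close> is the exponent in \<open>word_size_bound\<close>, and
  \<open>48\<close> accounts for the memory: \<open>16 * (n + 2) \<le> 48 * n\<close> for
  \<open>n \<ge> 1\<close>.\<close>
proof (rule exI[of _ "compile 0 validate"], rule exI[of _ 8],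
    rule exI[of _ "size_of validate + 48"], intro allI impI)
  fix wl :: "nat \<Rightarrow> nat" and n :: nat and A :: "int list"
  assume wl: "\<forall>n\<ge>1. real 8 * (log 2 (real n) + 1) \<le> real (wl n)"
    and n: "1 \<le> n" "length A = n" and fit: "\<forall>x\<in>set A. fits_word (wl n) x"
  have W: "(2 * n) ^ 8 \<le> (2::nat) ^ wl n" using wl n by (intro word_size_bound) auto
  have "border_array (take 0 A)" using border_array_take_iff[of 0 A] by (simp add: valid_def)
  then have st: "status A 0 (\<lambda>_. 0) (\<lambda>_ _. 0)" by (simp add: status_def invar_initial)
  have rep: "represents initial (\<lambda>_. 0) (\<lambda>_ _. 0)" by (simp add: represents_def initial_def)
  obtain ts X where run: "online_run (wl n) (compile 0 validate) initial A
      (map (\<lambda>j. border_array (take j A)) [1..<Suc n]) ts X"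
    and ts: "length ts = n" "\<forall>t\<in>set ts. t \<le> size_of validate" and X: "X \<subseteq> {..<16 * (n + 2)}"
    using online_run_validate[OF n(2,1) W fit _ rep st] by (auto simp del: upt_Suc)
  let ?C = "size_of validate + 48"
  have "\<forall>t\<in>set ts. t \<le> ?C" using ts by auto
  moreover have "sum_list ts \<le> length ts * ?C"
    using ts(2) by (induction ts) fastforce+
  moreover have "16 * (n + 2) \<le> ?C * n" using n by (simp add: distrib_right)
  then have "X \<subseteq> {..<?C * n}" using X by auto
  ultimately show "\<exists>answers times addresses.
           online_run (wl n) (compile 0 validate) initial A answers times addresses \<and>
           answers = map (\<lambda>i. border_array (take i A)) [1..<Suc n] \<and>
           (\<forall>t\<in>set times. t \<le> ?C) \<and>
           sum_list times \<le> ?C * n \<and>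
           addresses \<subseteq> {..<?C * n}"
    using run ts(1) by (intro exI[of _ ts] exI[of _ X] exI) (auto simp: mult.commute simp del: upt_Suc)
qed

end
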